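(* Let $X$ be a Banach space of type $p$, $1<p\le 2$, let $0<r<p'$ and $0<s<\infty$, and put $\alpha=\frac1s+\frac1{p'}-\frac1r$. Then for all precompact subsets $A\subset X$, $$(e_n(A))_n\in l_{r,s}\quad\text{implies}\quad (e_n(\mathrm{aco}(A)))_n\in l_{p',s,\alpha}.$$ The result is optimal in the following sense: if $\beta<\alpha$, then there exists a precompact subset $A\subset l_p$ such that $(e_n(A))_n\in l_{r,s}$ and $(e_n(\mathrm{aco}(A)))_n\notin l_{p',s,\beta}$.
   Context: $p'$ is the conjugate exponent, $1/p+1/p'=1$. $\log$ is the logarithm to base 2. $\mathrm{aco}(A)$ is the absolutely convex hull of $A$. A Banach space $X$ is of type $p$, $1\le p\le2$, if there is $\varrho>0$ with $\int_0^1\|\sum_{i=1}^k r_i(t)x_i\|\,dt\le\varrho(\sum_{i=1}^k\|x_i\|^p)^{1/p}$ for all $k\in\mathbb N$ and $x_1,\dots,x_k\in X$, where $r_i(t)=\mathrm{sign}(\sin(2^i\pi t))$ are the Rademacher functions. Entropy numbers: for a bounded subset $A$ of a metric space $M$, $\varepsilon_n(A)=\inf\{\varepsilon\ge0:\exists x_1,\dots,x_n\in M,\ A\subset\bigcup_{i=1}^n B_M(x_i,\varepsilon)\}$ with closed balls $B_M(x,\varepsilon)$, and the dyadic entropy numbers are $e_n(A)=\varepsilon_{2^{n-1}}(A)$. Generalized Lorentz sequence spaces: for $0<r<\infty$, $0<s\le\infty$, $\alpha\in\mathbb R$, a non-increasing bounded sequence $(\xi_n)_{n\ge1}$ of non-negative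 reals belongs to $l_{r,s,\alpha}$ iff $\sum_{n=1}^\infty(\log(n+1))^{-\alpha s}n^{s/r-1}\xi_n^s<\infty$ (if $s<\infty$), respectively $\sup_{n}(\log(n+1))^{-\alpha}n^{1/r}\xi_n<\infty$ (if $s=\infty$). One writes $l_{r,s}=l_{r,s,0}$. *)

theory Defs
  imports "HOL-Analysis.Analysis" "HOL-Library.Function_Algebras"
begin

definition rademacher :: "nat \<Rightarrow> real \<Rightarrow> real" where
  "rademacher i t = sgn (sin (2 ^ i * pi * t))"

definition of_type :: "'a::real_normed_vector itself \<Rightarrow> real \<Rightarrow> bool" where
  "of_type _ p \<longleftrightarrow> 1 \<le> p \<and> p \<le> 2 \<and>
     (\<exists>\<rho>>0. \<forall>(k::nat) (x :: nat \<Rightarrow> 'a).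
        integral {0..1} (\<lambda>t. norm (\<Sum>i=1..k. rademacher i t *\<^sub>R x i))
          \<le> \<rho> * (\<Sum>i=1..k. norm (x i) powr p) powr (1/p))"

definition entropy_number :: "'a set \<Rightarrow> ('a \<Rightarrow> 'a \<Rightarrow> real) \<Rightarrow> nat \<Rightarrow> 'a set \<Rightarrow> real" where
  "entropy_number M d n A =
     Inf {\<epsilon>. 0 \<le> \<epsilon> \<and> (\<exists>x :: nat \<Rightarrow> 'a. (\<forall>i\<in>{1..n}. x i \<in> M) \<and>
                            A \<subseteq> (\<Union>i\<in>{1..n}. Metric_space.mcball M d (x i) \<epsilon>))}"

text \<open>Only indices \<open>n \<ge> 1\<close> are meaningful; the value at \<open>0\<close> is never used.\<close>

definition dyadic_entropy_number :: "'a set \<Rightarrow> ('a \<Rightarrow> 'a \<Rightarrow> real) \<Rightarrow> 'a set \<Rightarrow> nat \<Rightarrow> real" where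
  "dyadic_entropy_number M d A n = entropy_number M d (2 ^ (n - 1)) A"

text \<open>
  The generalized Lorentz sequence space \<open>l\<^bsub>r,s,\<alpha>\<^esub>\<close> for finite \<open>s\<close>. A sequence
  \<open>(\<xi>\<^sub>n)\<close>, \<open>n \<ge> 1\<close>, is a function on \<open>nat\<close> whose value at \<open>0\<close> is ignored.
  Boundedness is automatic for non-increasing sequences of non-negative reals.
\<close>

definition lorentz :: "real \<Rightarrow> real \<Rightarrow> real \<Rightarrow> (nat \<Rightarrow> real) set" where
  "lorentz r s \<alpha> =
     {\<xi>. (\<forall>n\<ge>1. 0 \<le> \<xi> n) \<and> antimono_on {1..} \<xi> \<and>
         (\<lambda>n. log 2 (real n + 1) powr (- \<alpha> * s) * real n powr (s / r - 1) * \<xi> n powr s)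
           summable_on {1..}}"

definition absolutely_convex :: "'a::real_vector set \<Rightarrow> bool" where
  "absolutely_convex S \<longleftrightarrow>
     (\<forall>x\<in>S. \<forall>y\<in>S. \<forall>a b. \<bar>a\<bar> + \<bar>b\<bar> \<le> 1 \<longrightarrow> a *\<^sub>R x + b *\<^sub>R y \<in> S)"

definition aco :: "'a::real_vector set \<Rightarrow> 'a set" where
  "aco A = absolutely_convex hull A"

text \<open>
  The exponent of \<open>l\<^sub>p\<close> is a term, so \<open>l\<^sub>p\<close> is not a type of its own but a subset of
  the vector space of all real sequences (with pointwise operations), with its own metric.
\<close>

instantiation "fun" :: (type, real_vector) real_vector
begin

definition scaleR_fun :: "real \<Rightarrow> ('a \<Rightarrow> 'b) \<Rightarrow> 'a \<Rightarrow> 'b" where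
  "scaleR_fun c f = (\<lambda>x. c *\<^sub>R f x)"

instance
  by standard (simp_all add: scaleR_fun_def fun_eq_iff scaleR_add_right scaleR_add_left)

end

definition lp_space :: "real \<Rightarrow> (nat \<Rightarrow> real) set" where
  "lp_space p = {x. summable (\<lambda>n. \<bar>x n\<bar> powr p)}"

definition lp_norm :: "real \<Rightarrow> (nat \<Rightarrow> real) \<Rightarrow> real" where
  "lp_norm p x = (\<Sum>n. \<bar>x n\<bar> powr p) powr (1/p)"

definition lp_dist :: "real \<Rightarrow> (nat \<Rightarrow> real) \<Rightarrow> (nat \<Rightarrow> real) \<Rightarrow> real" where
  "lp_dist p x y = lp_norm p (x - y)"

lemma powr_convex_nonneg:
  fixes p t u v :: real
  assumes "1 \<le> p" "0 \<le> t" "t \<le> 1" "0 \<le> u" "0 \<le> v"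
  shows "(t * u + (1 - t) * v) powr p \<le> t * u powr p + (1 - t) * v powr p"
proof -
  have le: "w powr p \<le> w" if "0 \<le> w" "w \<le> 1" for w :: real
    using powr_mono'[of 1 p w] that assms(1) by auto
  consider "u = 0" | "v = 0" | "0 < u" "0 < v" using assms by linarith
  then show ?thesis
  proof cases
    case 1
    then show ?thesis
      using le[of "1 - t"] assms by (simp add: powr_mult mult_right_mono)
  next
    case 2
    then show ?thesis
      using le[of t] assms by (simp add: powr_mult mult_right_mono)
  next
    case 3
    then show ?thesis
      using convex_onD[OF powr_convex[OF assms(1)], of "1 - t" u v] assms by simp
  qed
qed

lemma lp_norm_nonneg: "0 \<le> lp_norm p x"
  by (simp add: lp_norm_def)

lemma lp_norm_powr:
  assumes "1 \<le> p" "x \<in> lp_space p"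
  shows "lp_norm p x powr p = (\<Sum>n. \<bar>x n\<bar> powr p)"
  using assms by (simp add: lp_norm_def lp_space_def powr_powr suminf_nonneg)

lemma lp_norm_eq_0_iff:
  assumes "1 \<le> p" "x \<in> lp_space p"
  shows "lp_norm p x = 0 \<longleftrightarrow> x = 0"
  using assms by (auto simp: lp_norm_def lp_space_def suminf_eq_zero_iff fun_eq_iff)

lemma lp_triangle:
  assumes p: "1 \<le> p" and x: "x \<in> lp_space p" and y: "y \<in> lp_space p"
  shows lp_space_add: "x + y \<in> lp_space p"
    and lp_norm_triangle: "lp_norm p (x + y) \<le> lp_norm p x + lp_norm p y"
proof -
  define a b where "a = lp_norm p x" and "b = lp_norm p y"
  have "x + y \<in> lp_space p \<and> lp_norm p (x + y) \<le> a + b"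
  proof (cases "a = 0 \<or> b = 0")
    case True
    then show ?thesis
      using lp_norm_eq_0_iff[OF p x] lp_norm_eq_0_iff[OF p y] x y by (auto simp: a_def b_def lp_norm_nonneg)
  next
    case False
    then have a: "0 < a" and b: "0 < b"
      using lp_norm_nonneg[of p x] lp_norm_nonneg[of p y] by (auto simp: a_def b_def)
    define t where "t = a / (a + b)"
    have t: "0 \<le> t" "t \<le> 1" and t1: "1 - t = b / (a + b)"
      using a b by (auto simp: t_def field_simps)
    define g where "g = (\<lambda>n. (a + b) powr p *
        (t * (\<bar>x n\<bar> powr p / a powr p) + (1 - t) * (\<bar>y n\<bar> powr p / b powr p)))"
    have le: "\<bar>(x + y) n\<bar> powr p \<le> g n" for n
    proof -
      have "\<bar>(x + y) n\<bar> \<le> (a + b) * (t * (\<bar>x n\<bar> / a) + (1 - t) * (\<bar>y n\<bar> / b))"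
      proof -
        have "(a + b) * (t * (\<bar>x n\<bar> / a) + (1 - t) * (\<bar>y n\<bar> / b)) = \<bar>x n\<bar> + \<bar>y n\<bar>"
          unfolding t1 using a b by (simp add: t_def distrib_left)
        then show ?thesis by simp
      qed
      then have "\<bar>(x + y) n\<bar> powr p
          \<le> ((a + b) * (t * (\<bar>x n\<bar> / a) + (1 - t) * (\<bar>y n\<bar> / b))) powr p"
        using p by (intro powr_mono2) auto
      also have "\<dots> = (a + b) powr p * (t * (\<bar>x n\<bar> / a) + (1 - t) * (\<bar>y n\<bar> / b)) powr p"
        using a b t by (simp add: powr_mult)
      also have "\<dots> \<le> (a + b) powr p *
          (t * (\<bar>x n\<bar> / a) powr p + (1 - t) * (\<bar>y n\<bar> / b) powr p)"
        using a b t p by (intro mult_left_mono powr_convex_nonneg) auto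
      also have "\<dots> = g n"
        using a b by (simp add: g_def powr_divide)
      finally show ?thesis .
    qed
    have sx: "(\<lambda>n. \<bar>x n\<bar> powr p) sums (a powr p)" and sy: "(\<lambda>n. \<bar>y n\<bar> powr p) sums (b powr p)"
      using x y lp_norm_powr[OF p x] lp_norm_powr[OF p y]
      by (auto simp: a_def b_def lp_space_def sums_iff)
    have "g sums ((a + b) powr p * (t * (a powr p / a powr p) + (1 - t) * (b powr p / b powr p)))"
      unfolding g_def by (intro sums_mult sums_add sums_divide sx sy)
    then have g: "g sums ((a + b) powr p)" using a b by simp
    have sum: "summable (\<lambda>n. \<bar>(x + y) n\<bar> powr p)"
      by (rule summable_comparison_test'[OF sums_summable[OF g], of 0]) (use le in auto)
    have "(\<Sum>n. \<bar>(x + y) n\<bar> powr p) \<le> (a + b) powr p"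
      using suminf_le[OF le sum sums_summable[OF g]] sums_unique[OF g] by simp
    then have "lp_norm p (x + y) \<le> ((a + b) powr p) powr (1/p)"
      unfolding lp_norm_def using p sum by (intro powr_mono2) (auto intro: suminf_nonneg)
    also have "\<dots> = a + b" using a b p by (simp add: powr_powr)
    finally show ?thesis using sum by (simp add: lp_space_def)
  qed
  then show "x + y \<in> lp_space p" "lp_norm p (x + y) \<le> lp_norm p x + lp_norm p y"
    by (auto simp: a_def b_def)
qed

lemma Metric_space_lp:
  assumes p: "1 \<le> p"
  shows "Metric_space (lp_space p) (lp_dist p)"
proof -
  have minus: "x - y \<in> lp_space p" if "x \<in> lp_space p" "y \<in> lp_space p" for x y
    using lp_space_add[OF p, of x "- y"] that by (simp add: lp_space_def)
  show ?thesis
  proof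
    show "lp_dist p x y = lp_dist p y x" for x y
      by (simp add: lp_dist_def lp_norm_def abs_minus_commute)
    show "lp_dist p x z \<le> lp_dist p x y + lp_dist p y z"
      if "x \<in> lp_space p" "y \<in> lp_space p" "z \<in> lp_space p" for x y z
      using lp_norm_triangle[OF p minus[of x y] minus[of y z]] that by (simp add: lp_dist_def)
  qed (use lp_norm_eq_0_iff[OF p minus] in \<open>auto simp: lp_dist_def lp_norm_nonneg\<close>)
qed

end

theory Submission
  imports Defs
begin

text \<open>
  Only the entropy numbers \<open>e_n\<close> with \<open>n = 2^j\<close> matter: since entropy numbers decrease,
  membership in \<open>l_{r,s,\<alpha>}\<close> is equivalent to the convergence of
  \<open>\<Sum>\<^sub>j (j+1)^(-\<alpha>s) 2^(js/r) e_{2^j}^s\<close> (lemma \<open>lorentz_iff_dyadic\<close>).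

  For the implication, take nets \<open>N_k\<close> of \<open>A\<close> with at most \<open>2^(2^k - 1)\<close> points and radius
  \<open>\<epsilon>_k\<close> slightly above \<open>e_{2^k}(A)\<close>. A point of \<open>N_{k+1}\<close> is a point of \<open>N_k\<close> plus a difference
  from a set \<open>D_k\<close> of at most \<open>2^(2^(k+1) - 1)\<close> vectors of norm at most \<open>2\<epsilon>_k\<close>. Minkowski sums of
  absolutely convex sets are absolutely convex, so for \<open>i \<le> j\<close>
  \<open>aco A \<subseteq> aco N_i + \<Sum>\<^sub>{i \<le> k < j} aco D_k + (ball of radius \<epsilon>_j)\<close>,
  and the summands can be covered separately. Put \<open>n = 2^j\<close> and choose \<open>i\<close> with \<open>2^i\<close> comparable to
  \<open>j = log n\<close>. Then \<open>N_i\<close> has at most \<open>\<surd>n\<close> points, so that \<open>aco N_i\<close> is a low-dimensional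
  polytope for which a grid of coefficients gives a negligible radius (\<open>coarse_level_cover\<close>). The
  sets \<open>aco D_k\<close> are covered by Maurey's empirical method (\<open>maurey_cover\<close>): in a space of type \<open>p\<close>
  every point of the convex hull of \<open>m\<close> vectors of norm at most \<open>\<delta>\<close> lies within
  \<open>C \<delta> \<nu>^(-1/p')\<close> of an average of \<open>\<nu>\<close> of them, and there are at most \<open>m^\<nu>\<close> such averages. With
  \<open>\<nu>_k\<close> proportional to \<open>2^(j-k) 2^(-\<eta>(k-i))\<close> the total number of balls stays below
  \<open>2^(2^j - 1)\<close>, and the radii add up to
  \<open>2^(-j/p') \<Sum>\<^sub>{k \<ge> i} \<epsilon>_k 2^(k/p') 2^(\<eta>(k-i)/p')\<close> up to a constant (\<open>aco_entropy_bound\<close>). As \<open>1/r > 1/p'\<close>,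
  a small \<open>\<eta>\<close> makes this sum \<open>2^(-i(1/r - 1/p'))\<close> times a geometrically weighted average of
  \<open>\<epsilon>_k 2^(k/r)\<close>, a sequence in \<open>l_s\<close> by hypothesis. A Hardy inequality
  (\<open>geometric_average_powr_summable\<close>) then gives the claim: about \<open>2^i\<close> values of \<open>j\<close> share one
  \<open>i\<close>, and this is where the exponent \<open>\<alpha>\<close> comes from.

  Maurey's method is proved without probability. By the type inequality some choice of signs makes
  a signed sum small. Keeping the smaller of the two sign classes and doubling its weight
  changes the sum by no more than that signed sum, and iterating this thins a long sum
  to \<open>\<nu>\<close> terms with an error controlled by a geometric series (\<open>sign_halving\<close>).

  For the optimality, take \<open>A = {t_i u_i}\<close> with the unit vectors \<open>u_i\<close> of \<open>l\<^sub>p\<close> and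
  \<open>t_i = (1 + log (i+1))^(-a)\<close>, \<open>a = 1/r + (\<alpha> - \<beta>)\<close>. Covering the first \<open>2^(n-1) - 1\<close> points singly
  gives \<open>e_n(A) \<le> n^(-a)\<close>. On the other hand \<open>aco A\<close> contains the averages of \<open>N\<close> vectors
  \<open>c u_i\<close>, one from each of \<open>N\<close> blocks of \<open>q\<close> coordinates; a small ball contains few of
  these \<open>q^N\<close> vectors, because those in one ball must agree in at least half of the blocks
  (\<open>code_vectors_cover_radius\<close>). With \<open>q\<close> about \<open>n^2\<close> and \<open>N\<close> about \<open>n / log n\<close> this
  forces \<open>e_n(aco A) \<ge> const (log n)^(1/p' - a) n^(-1/p')\<close>, and the condensed series
  for \<open>l_{p',s,\<beta>}\<close> dominates the harmonic series.
\<close>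

section \<open>Dyadic condensation of Lorentz sums\<close>

lemma powr_comparable:
  fixes a x \<gamma> :: real
  assumes "0 < a" "a / 2 \<le> x" "x \<le> 2 * a"
  shows "2 powr (- \<bar>\<gamma>\<bar>) * a powr \<gamma> \<le> x powr \<gamma>" "x powr \<gamma> \<le> 2 powr \<bar>\<gamma>\<bar> * a powr \<gamma>"
proof -
  have x: "x = (x / a) * a" and "1 / 2 \<le> x / a" "x / a \<le> 2" using assms by (auto simp: field_simps)
  then have xa: "x powr \<gamma> = (x / a) powr \<gamma> * a powr \<gamma>"
    using assms by (metis less_eq_real_def less_le_trans half_gt_zero powr_mult zero_less_divide_iff)
  have "0 < x / a" using assms by auto
  have "\<bar>ln (x / a)\<bar> \<le> ln 2"
  proof -
    have "ln (x / a) \<le> ln 2" using \<open>x / a \<le> 2\<close> \<open>0 < x/a\<close> by (subst ln_le_cancel_iff) auto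
    moreover have "ln (1/2) \<le> ln (x / a)" using \<open>1 / 2 \<le> x / a\<close> \<open>0 < x/a\<close> by (subst ln_le_cancel_iff) auto
    ultimately show ?thesis by (auto simp: ln_div)
  qed
  then have "\<bar>\<gamma> * ln (x / a)\<bar> \<le> \<bar>\<gamma>\<bar> * ln 2" by (simp add: abs_mult mult_left_mono)
  then have "2 powr (- \<bar>\<gamma>\<bar>) \<le> (x / a) powr \<gamma>" "(x / a) powr \<gamma> \<le> 2 powr \<bar>\<gamma>\<bar>"
    using \<open>0 < x/a\<close> by (auto simp: powr_def)
  then show "2 powr (- \<bar>\<gamma>\<bar>) * a powr \<gamma> \<le> x powr \<gamma>" "x powr \<gamma> \<le> 2 powr \<bar>\<gamma>\<bar> * a powr \<gamma>"
    unfolding xa by (auto intro: mult_right_mono)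
qed

lemma sum_dyadic_blocks:
  fixes f :: "nat \<Rightarrow> real"
  shows "(\<Sum>j<J. \<Sum>n\<in>{2^j..<2^Suc j}. f n) = (\<Sum>n\<in>{1..<2^J}. f n)"
proof (induction J)
  case (Suc J)
  have "{1..<2^Suc J} = {1..<2^J} \<union> {2^J..<2^Suc J :: nat}"
    using ivl_disj_un_two(3)[of 1 "2^J" "2^Suc J :: nat"] by simp
  then have "(\<Sum>n\<in>{1..<2^Suc J}. f n) = (\<Sum>n\<in>{1..<2^J}. f n) + (\<Sum>n\<in>{2^J..<2^Suc J}. f n)"
    by (simp only:) (rule sum.union_disjoint, auto)
  with Suc show ?case by simp
qed simp

lemma summable_on_iff_dyadic_blocks:
  fixes f :: "nat \<Rightarrow> real"
  assumes nonneg: "\<And>n. 1 \<le> n \<Longrightarrow> 0 \<le> f n"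
  shows "f summable_on {1..} \<longleftrightarrow> summable (\<lambda>j. \<Sum>n\<in>{2^j..<2^Suc j}. f n)"
proof
  assume f: "f summable_on {1..}"
  have nn: "0 \<le> f n" if "n \<in> {2^j..<2^Suc j}" for n j
    using that order_trans[OF one_le_power[of "2::nat" j]] by (intro nonneg) auto
  show "summable (\<lambda>j. \<Sum>n\<in>{2^j..<2^Suc j}. f n)"
  proof (rule summableI_nonneg_bounded)
    fix J
    show "(\<Sum>j<J. \<Sum>n\<in>{2^j..<2^Suc j}. f n) \<le> infsum f {1..}"
      unfolding sum_dyadic_blocks by (rule finite_sum_le_infsum[OF f]) (auto intro: nonneg)
  qed (use nn in \<open>auto intro!: sum_nonneg\<close>)
next
  assume s: "summable (\<lambda>j. \<Sum>n\<in>{2^j..<2^Suc j}. f n)"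
  have nn: "0 \<le> f n" if "n \<in> {2^j..<2^Suc j}" for n j
    using that order_trans[OF one_le_power[of "2::nat" j]] by (intro nonneg) auto
  show "f summable_on {1..}"
  proof (rule nonneg_bdd_above_summable_on)
    show "bdd_above (sum f ` {F. F \<subseteq> {1..} \<and> finite F})"
    proof (rule bdd_aboveI2)
      fix F :: "nat set" assume F: "F \<in> {F. F \<subseteq> {1..} \<and> finite F}"
      obtain J where J: "\<And>n. n \<in> F \<Longrightarrow> n < J"
        using F finite_nat_set_iff_bounded[of F] by auto
      have "F \<subseteq> {1..<2^J}" using F less_trans[OF J less_exp[of J]] by auto
      then have "sum f F \<le> (\<Sum>n\<in>{1..<2^J}. f n)"
        by (intro sum_mono2) (auto intro: nonneg)
      also have "\<dots> \<le> (\<Sum>j. \<Sum>n\<in>{2^j..<2^Suc j}. f n)"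
        unfolding sum_dyadic_blocks[symmetric]
        by (intro sum_le_suminf[OF s]) (use nn in \<open>auto intro!: sum_nonneg\<close>)
      finally show "sum f F \<le> (\<Sum>j. \<Sum>n\<in>{2^j..<2^Suc j}. f n)" .
    qed
  qed (use nonneg in auto)
qed

text \<open>
  The condensed form of the Lorentz sum: block \<open>{2^j..<2^(j+1)}\<close> consists of \<open>2^j\<close> terms
  of comparable weight.
\<close>

definition lorentz_term :: "real \<Rightarrow> real \<Rightarrow> real \<Rightarrow> (nat \<Rightarrow> real) \<Rightarrow> nat \<Rightarrow> real" where
  "lorentz_term r s a \<xi> j = real (j + 1) powr (- a * s) * 2 powr (real j * s / r) * \<xi> (2 ^ j) powr s"

lemma lorentz_weight_comparable:
  fixes \<gamma> \<kappa> :: real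
  assumes n: "2^j \<le> n" "n < 2 ^ Suc j"
  shows "2 powr (- \<bar>\<gamma>\<bar> - \<bar>\<kappa>\<bar>) * (real (j + 1) powr \<gamma> * 2 powr (real j * \<kappa>))
           \<le> log 2 (real n + 1) powr \<gamma> * real n powr \<kappa>"
    and "log 2 (real n + 1) powr \<gamma> * real n powr \<kappa>
           \<le> 2 powr (\<bar>\<gamma>\<bar> + \<bar>\<kappa>\<bar>) * (real (j + 1) powr \<gamma> * 2 powr (real j * \<kappa>))"
proof -
  have n1: "real n + 1 \<le> 2 ^ Suc j" using n(2)
    by (metis Suc_eq_plus1 Suc_leI of_nat_1 of_nat_add of_nat_le_iff of_nat_numeral of_nat_power)
  have n2: "2 ^ j \<le> real n" using n(1)
    by (metis of_nat_le_iff of_nat_numeral of_nat_power)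
  have "log 2 (real n + 1) \<le> log 2 (2 ^ Suc j)" using n1 by simp
  then have up: "log 2 (real n + 1) \<le> real (j + 1)" by (simp only: log_pow_cancel)
  have lo: "real (j + 1) / 2 \<le> log 2 (real n + 1)"
  proof (cases "j = 0")
    case True
    then have "n = 1" using n by auto
    then show ?thesis using True by simp
  next
    case False
    have "log 2 (2 ^ j) \<le> log 2 (real n + 1)" using order_trans[OF n2, of "real n + 1"] by (subst log_le_cancel_iff) auto
    then show ?thesis using False by simp
  qed
  note c1 = powr_comparable[of "real (j + 1)" "log 2 (real n + 1)" \<gamma>, OF _ lo]
  have c2: "2 powr (- \<bar>\<kappa>\<bar>) * 2 powr (real j * \<kappa>) \<le> real n powr \<kappa>"
     "real n powr \<kappa> \<le> 2 powr \<bar>\<kappa>\<bar> * 2 powr (real j * \<kappa>)"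
    using powr_comparable[of "2 ^ j" "real n" \<kappa>] n1 n2
    by (auto simp: powr_realpow[symmetric] powr_powr)
  show "2 powr (- \<bar>\<gamma>\<bar> - \<bar>\<kappa>\<bar>) * (real (j + 1) powr \<gamma> * 2 powr (real j * \<kappa>))
           \<le> log 2 (real n + 1) powr \<gamma> * real n powr \<kappa>"
    using mult_mono[OF c1(1) c2(1)] up by (auto simp: powr_diff powr_minus field_simps)
  show "log 2 (real n + 1) powr \<gamma> * real n powr \<kappa>
           \<le> 2 powr (\<bar>\<gamma>\<bar> + \<bar>\<kappa>\<bar>) * (real (j + 1) powr \<gamma> * 2 powr (real j * \<kappa>))"
    using mult_mono[OF c1(2) c2(2)] up by (auto simp: powr_add field_simps)
qed

text \<open>
  Both weights of the Lorentz sum are constant on a dyadic block up to a factor, and the sequence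
  is monotone, so the block sum lies between multiples of two neighbouring condensed terms.
\<close>

lemma lorentz_iff_dyadic:
  fixes r s a :: real
  assumes "0 < r" "0 < s" and nonneg: "\<And>n. 1 \<le> n \<Longrightarrow> 0 \<le> \<xi> n" and anti: "antimono_on {1..} \<xi>"
  shows "\<xi> \<in> lorentz r s a \<longleftrightarrow> summable (lorentz_term r s a \<xi>)"
proof -
  define f where "f n = log 2 (real n + 1) powr (- a * s) * real n powr (s / r - 1) * \<xi> n powr s" for n
  define D where "D = \<bar>- a * s\<bar> + \<bar>s / r - 1\<bar>"
  have weight: "2 ^ j * (real (j + 1) powr (- a * s) * 2 powr (real j * (s / r - 1)))
      = real (j + 1) powr (- a * s) * 2 powr (real j * s / r)" for j :: nat
    using \<open>0 < r\<close> by (simp add: algebra_simps powr_diff powr_realpow)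
  have pos: "1 \<le> (2::nat) ^ j" for j by simp
  have upper: "(\<Sum>n\<in>{2^j..<2^Suc j}. f n) \<le> 2 powr D * lorentz_term r s a \<xi> j" for j
  proof -
    have "f n \<le> 2 powr D * (real (j + 1) powr (- a * s) * 2 powr (real j * (s / r - 1))) * \<xi> (2^j) powr s"
      if n: "n \<in> {2^j..<2^Suc j}" for n
    proof -
      have "1 \<le> n" using n pos[of j] by (metis atLeastLessThan_iff order_trans)
      then have "\<xi> n \<le> \<xi> (2^j)" using n by (intro monotone_onD[OF anti]) auto
      then show ?thesis unfolding f_def D_def using n nonneg[OF \<open>1 \<le> n\<close>] \<open>0 < s\<close>
        by (intro mult_mono lorentz_weight_comparable powr_mono2) auto
    qed
    then have "(\<Sum>n\<in>{2^j..<2^Suc j}. f n) \<le>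
       (\<Sum>n\<in>{2^j..<2^Suc j::nat}. 2 powr D * (real (j + 1) powr (- a * s) * 2 powr (real j * (s / r - 1))) * \<xi> (2^j) powr s)"
      by (rule sum_mono)
    also have "\<dots> = 2 powr D * (2 ^ j * (real (j + 1) powr (- a * s) * 2 powr (real j * (s / r - 1)))) * \<xi> (2^j) powr s"
      by simp
    finally show ?thesis unfolding weight lorentz_term_def by (simp add: mult.assoc)
  qed
  have lower: "2 powr (- D) * (real (j + 1) powr (- a * s) * 2 powr (real j * s / r)) * \<xi> (2^Suc j) powr s
      \<le> (\<Sum>n\<in>{2^j..<2^Suc j}. f n)" for j
  proof -
    have "2 powr (- D) * (real (j + 1) powr (- a * s) * 2 powr (real j * (s / r - 1))) * \<xi> (2^Suc j) powr s \<le> f n"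
      if n: "n \<in> {2^j..<2^Suc j}" for n
    proof -
      have "1 \<le> n" using n pos[of j] by (metis atLeastLessThan_iff order_trans)
      then have "\<xi> (2^Suc j) \<le> \<xi> n" using n pos[of "Suc j"] by (intro monotone_onD[OF anti]) auto
      then show ?thesis unfolding f_def D_def using n nonneg[OF pos[of "Suc j"]] \<open>0 < s\<close>
          lorentz_weight_comparable(1)[of j n "- a * s" "s/r - 1"]
        by (intro mult_mono[where b = "log 2 (real n + 1) powr (- a * s) * real n powr (s / r - 1)"] powr_mono2)
          (auto simp del: power_Suc)
    qed
    then have "(\<Sum>n\<in>{2^j..<2^Suc j::nat}. 2 powr (- D) * (real (j + 1) powr (- a * s) * 2 powr (real j * (s / r - 1))) * \<xi> (2^Suc j) powr s)
      \<le> (\<Sum>n\<in>{2^j..<2^Suc j}. f n)"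
      by (rule sum_mono)
    also have "(\<Sum>n\<in>{2^j..<2^Suc j::nat}. 2 powr (- D) * (real (j + 1) powr (- a * s) * 2 powr (real j * (s / r - 1))) * \<xi> (2^Suc j) powr s)
        = 2 powr (- D) * (2 ^ j * (real (j + 1) powr (- a * s) * 2 powr (real j * (s / r - 1)))) * \<xi> (2^Suc j) powr s"
      by simp
    finally show ?thesis unfolding weight .
  qed
  have shift: "lorentz_term r s a \<xi> (Suc j) \<le> 2 powr (\<bar>a * s\<bar> + s / r + D) *
      (2 powr (- D) * (real (j + 1) powr (- a * s) * 2 powr (real j * s / r)) * \<xi> (2^Suc j) powr s)" for j
  proof -
    have "real (Suc j + 1) powr (- a * s) \<le> 2 powr \<bar>- a * s\<bar> * real (j + 1) powr (- a * s)"
      by (rule powr_comparable) auto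
    then have "lorentz_term r s a \<xi> (Suc j) \<le>
       (2 powr \<bar>- a * s\<bar> * real (j + 1) powr (- a * s)) * 2 powr (real (Suc j) * s / r) * \<xi> (2^Suc j) powr s"
      unfolding lorentz_term_def by (intro mult_right_mono) auto
    also have "2 powr (real (Suc j) * s / r) = 2 powr (s / r) * 2 powr (real j * s / r)"
      by (simp add: powr_add[symmetric] field_simps add_divide_distrib)
    finally show ?thesis by (simp add: powr_add powr_minus field_simps)
  qed
  have fnn: "0 \<le> f n" for n unfolding f_def by simp
  have "f summable_on {1..} \<longleftrightarrow> summable (lorentz_term r s a \<xi>)"
    unfolding summable_on_iff_dyadic_blocks[OF fnn]
  proof
    assume *: "summable (\<lambda>j. \<Sum>n\<in>{2^j..<2^Suc j}. f n)"
    have "summable (\<lambda>j. lorentz_term r s a \<xi> (Suc j))"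
    proof (rule summable_comparison_test'[where N = 0])
      show "summable (\<lambda>j. 2 powr (\<bar>a * s\<bar> + s / r + D) * (\<Sum>n\<in>{2^j..<2^Suc j}. f n))"
        using * by (rule summable_mult)
      show "norm (lorentz_term r s a \<xi> (Suc j)) \<le> 2 powr (\<bar>a * s\<bar> + s / r + D) * (\<Sum>n\<in>{2^j..<2^Suc j}. f n)" for j
        using order_trans[OF shift mult_left_mono[OF lower]] by (auto simp: lorentz_term_def)
    qed
    then show "summable (lorentz_term r s a \<xi>)" by (simp add: summable_Suc_iff)
  next
    assume *: "summable (lorentz_term r s a \<xi>)"
    show "summable (\<lambda>j. \<Sum>n\<in>{2^j..<2^Suc j}. f n)"
      by (rule summable_comparison_test'[where N = 0, OF summable_mult[OF *, of "2 powr D"]])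
        (use upper fnn in \<open>auto simp: sum_nonneg\<close>)
  qed
  then show ?thesis using nonneg anti unfolding lorentz_def f_def by auto
qed

section \<open>Elementary summability facts\<close>

text \<open>
  A discrete Hardy inequality, valid also for \<open>s < 1\<close>: half of the geometric decay is spent on
  bounding the sum by its largest term, and the \<open>s\<close>-th power of a maximum is at most the sum
  of the \<open>s\<close>-th powers. The bound \<open>V i\<close> is therefore a convolution of \<open>b k powr s\<close> with a
  geometric sequence, which is summable.
\<close>

lemma geometric_average_powr_summable:
  fixes b :: "nat \<Rightarrow> real" and s \<mu> :: real
  assumes b: "\<And>k. 0 \<le> b k" and s: "0 < s" and \<mu>: "0 < \<mu>" and sum: "summable (\<lambda>k. b k powr s)"
  obtains V :: "nat \<Rightarrow> real" and G :: real where "summable V" "\<And>i. 0 \<le> V i" "0 < G"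
    "\<And>i j. (\<Sum>k=i..j. b k * 2 powr (- \<mu> * real (k - i))) powr s \<le> G * V i"
proof -
  \<comment> \<open>The square root of the geometric ratio: one factor \<open>q\<close> bounds the maximum, the other sums.\<close>
  define q where "q = 2 powr (- \<mu> / 2)"
  define \<theta> where "\<theta> = q powr s"
  have q: "0 < q" "q < 1" using \<mu> by (auto simp: q_def powr_less_one)
  have \<theta>: "0 < \<theta>" "\<theta> < 1" using q s by (auto simp: \<theta>_def powr01_less_one)
  define B where "B = (\<Sum>k. b k powr s)"
  define V where "V i = (\<Sum>m. b (i + m) powr s * \<theta> ^ m)" for i
  have bB: "(\<Sum>i<n. b (i + m) powr s) \<le> B" for m n
  proof -
    have "(\<Sum>i<n. b (i + m) powr s) = (\<Sum>k\<in>{m..<n+m}. b k powr s)"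
      using sum.shift_bounds_nat_ivl[of "\<lambda>k. b k powr s" 0 m n] by (simp add: atLeast0LessThan)
    also have "\<dots> \<le> B" unfolding B_def by (intro sum_le_suminf sum) auto
    finally show ?thesis .
  qed
  have b1: "b k powr s \<le> B" for k using bB[of k 1] by simp
  have B0: "0 \<le> B" using b1[of 0] powr_ge_zero order_trans by blast
  have geo: "summable (\<lambda>m. B * \<theta> ^ m)" using \<theta> by (intro summable_mult summable_geometric) auto
  have sV: "summable (\<lambda>m. b (i + m) powr s * \<theta> ^ m)" for i
    by (rule summable_comparison_test'[where N = 0, OF geo]) (use b1 \<theta> in \<open>auto intro!: mult_right_mono\<close>)
  have V0: "0 \<le> V i" for i unfolding V_def using \<theta> by (intro suminf_nonneg sV) auto
  have "summable V"
  proof (rule summableI_nonneg_bounded[OF V0])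
    fix n
    have "(\<Sum>i<n. V i) = (\<Sum>m. \<Sum>i<n. b (i + m) powr s * \<theta> ^ m)"
      unfolding V_def by (rule suminf_sum[symmetric]) (rule sV)
    also have "\<dots> \<le> (\<Sum>m. B * \<theta> ^ m)"
    proof (rule suminf_le[OF _ _ geo])
      show "(\<Sum>i<n. b (i + m) powr s * \<theta> ^ m) \<le> B * \<theta> ^ m" for m
        using bB[where m=m and n=n] \<theta> by (simp add: sum_distrib_right[symmetric] mult_right_mono)
      show "summable (\<lambda>m. \<Sum>i<n. b (i + m) powr s * \<theta> ^ m)" by (intro summable_sum sV)
    qed
    finally show "(\<Sum>i<n. V i) \<le> (\<Sum>m. B * \<theta> ^ m)" .
  qed
  moreover have "(\<Sum>k=i..j. b k * 2 powr (- \<mu> * real (k - i))) powr s \<le> (1 / (1 - q)) powr s * V i" for i j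
  proof -
    have step: "b k * 2 powr (- \<mu> * real (k - i)) \<le> V i powr (1/s) * q ^ (k - i)" if k: "k \<in> {i..j}" for k
    proof -
      have "2 powr (- \<mu> * real (k - i)) = q ^ (k - i) * q ^ (k - i)"
        by (simp add: q_def powr_realpow[symmetric] powr_powr powr_add[symmetric] del: powr_realpow)
      moreover have "b k * q ^ (k - i) \<le> V i powr (1/s)"
      proof -
        have "(b k * q ^ (k - i)) powr s = b k powr s * \<theta> ^ (k - i)"
          using q b[of k] by (simp add: powr_mult \<theta>_def powr_realpow[symmetric] powr_powr mult.commute del: powr_realpow)
        also have "\<dots> \<le> V i"
          using sum_le_suminf[OF sV[of i], of "{k - i}"] \<theta> k by (auto simp: V_def)
        finally have "((b k * q ^ (k - i)) powr s) powr (1/s) \<le> V i powr (1/s)"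
          using s by (intro powr_mono2) auto
        then show ?thesis using s b[of k] q by (simp add: powr_powr)
      qed
      ultimately show ?thesis using q by (simp add: mult_right_mono mult.assoc[symmetric])
    qed
    have "(\<Sum>k=i..j. b k * 2 powr (- \<mu> * real (k - i))) \<le> (\<Sum>k=i..j. V i powr (1/s) * q ^ (k - i))"
      by (rule sum_mono[OF step])
    also have "\<dots> = V i powr (1/s) * (\<Sum>k=i..j. q ^ (k - i))" by (simp add: sum_distrib_left)
    also have "(\<Sum>k=i..j. q ^ (k - i)) = (\<Sum>m\<in>(\<lambda>k. k - i) ` {i..j}. q ^ m)"
      by (subst sum.reindex) (auto intro!: inj_onI)
    also have "\<dots> \<le> (\<Sum>m. q ^ m)" using q by (intro sum_le_suminf summable_geometric) auto
    also have "\<dots> = 1 / (1 - q)" using q by (simp add: suminf_geometric)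
    finally have "(\<Sum>k=i..j. b k * 2 powr (- \<mu> * real (k - i))) powr s \<le> (V i powr (1/s) * (1 / (1 - q))) powr s"
      using s b by (intro powr_mono2) (simp_all add: sum_nonneg mult_left_mono)
    also have "\<dots> = (1 / (1 - q)) powr s * V i" using q s V0[of i] by (simp add: powr_mult powr_powr powr_divide)
    finally show ?thesis .
  qed
  moreover have "0 < (1 / (1 - q)) powr s" using q by simp
  ultimately show ?thesis using V0 by (intro that) auto
qed

text \<open>
  Exponential growth beats any power: \<open>exp x \<ge> x\<close> applied to a small multiple of \<open>j\<close> absorbs the
  polynomial factor into half of the geometric decay.
\<close>

lemma summable_poly_geometric:
  fixes \<gamma> \<delta> :: real
  assumes \<delta>: "0 < \<delta>"
  shows "summable (\<lambda>j. real (j + 1) powr \<gamma> * 2 powr (- \<delta> * real j))"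
proof -
  define g where "g = \<bar>\<gamma>\<bar> + 1"
  define \<theta> where "\<theta> = \<delta> / (2 * g)"
  have g: "0 < g" "\<gamma> \<le> g" and \<theta>: "0 < \<theta>" "\<theta> * g = \<delta> / 2"
    using \<delta> zero_less_abs_iff[of \<gamma>] by (auto simp: g_def \<theta>_def field_simps)
  define c where "c = (\<theta> * ln 2) powr (- g)"
  have le: "real (j + 1) powr \<gamma> * 2 powr (- \<delta> * real j) \<le> c * 2 powr (\<delta> / 2) * (2 powr (- \<delta> / 2)) ^ j" for j
  proof -
    define x where "x = real (j + 1)"
    have x: "1 \<le> x" by (simp add: x_def)
    have "\<theta> * ln 2 * x \<le> 2 powr (\<theta> * x)"
      using order_trans[OF _ exp_ge_add_one_self[of "\<theta> * x * ln 2"], of "\<theta> * x * ln 2"] by (simp add: powr_def mult_ac)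
    then have "(\<theta> * ln 2 * x) powr g \<le> (2 powr (\<theta> * x)) powr g"
      using \<theta> x g by (intro powr_mono2) auto
    also have "\<dots> = 2 powr (\<delta> / 2 * x)" unfolding \<theta>(2)[symmetric] powr_powr by (simp add: mult_ac)
    finally have "x powr g \<le> c * 2 powr (\<delta> / 2 * x)"
      using \<theta> x by (simp add: powr_mult c_def powr_minus field_simps)
    then have "x powr \<gamma> \<le> c * 2 powr (\<delta> / 2 * x)" using powr_mono[OF g(2) x] by linarith
    then have "x powr \<gamma> * 2 powr (- \<delta> * real j) \<le> c * 2 powr (\<delta> / 2 * x) * 2 powr (- \<delta> * real j)"
      by (rule mult_right_mono) simp
    also have "\<dots> = c * (2 powr (\<delta> / 2) * 2 powr (- \<delta> / 2 * real j))"
      unfolding mult.assoc powr_add[symmetric] by (simp add: x_def algebra_simps add_divide_distrib diff_divide_distrib)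
    finally show ?thesis by (simp add: x_def powr_realpow[symmetric] powr_powr mult.assoc)
  qed
  show ?thesis
  proof (rule summable_comparison_test'[where N = 0])
    show "summable (\<lambda>j. c * 2 powr (\<delta> / 2) * (2 powr (- \<delta> / 2)) ^ j)"
      using \<delta> by (intro summable_mult summable_geometric) (simp add: powr_less_one)
  qed (use le in auto)
qed

lemma powr_add_le:
  fixes x y s :: real
  assumes "0 \<le> x" "0 \<le> y" "0 < s"
  shows "(x + y) powr s \<le> 2 powr s * (x powr s + y powr s)"
proof -
  have "(x + y) powr s \<le> (2 * max x y) powr s" using assms by (intro powr_mono2) auto
  also have "\<dots> = 2 powr s * max x y powr s" using assms by (simp add: powr_mult)
  also have "max x y powr s \<le> x powr s + y powr s" by (auto simp: max_def)
  finally show ?thesis by (simp add: mult_left_mono)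
qed

section \<open>Covers and entropy numbers\<close>

context Metric_space
begin

lemma entropy_cover_exists:
  assumes "x0 \<in> M" "A \<subseteq> mcball x0 R" "1 \<le> n"
  shows "{\<epsilon>. 0 \<le> \<epsilon> \<and> (\<exists>x :: nat \<Rightarrow> 'a. (\<forall>i\<in>{1..n}. x i \<in> M) \<and> A \<subseteq> (\<Union>i\<in>{1..n}. mcball (x i) \<epsilon>))} \<noteq> {}"
proof -
  have "A \<subseteq> (\<Union>i\<in>{1..n}. mcball x0 (max R 0))"
    using assms mcball_subset_concentric[of R "max R 0" x0] by auto
  then have "max R 0 \<in> {\<epsilon>. 0 \<le> \<epsilon> \<and> (\<exists>x :: nat \<Rightarrow> 'a. (\<forall>i\<in>{1..n}. x i \<in> M) \<and> A \<subseteq> (\<Union>i\<in>{1..n}. mcball (x i) \<epsilon>))}"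
    using assms by (auto intro!: exI[of _ "\<lambda>_. x0"])
  then show ?thesis by blast
qed

lemma entropy_number_le:
  assumes "0 \<le> \<epsilon>" "finite F" "F \<noteq> {}" "card F \<le> n" "F \<subseteq> M" "A \<subseteq> (\<Union>x\<in>F. mcball x \<epsilon>)"
  shows "entropy_number M d n A \<le> \<epsilon>"
proof -
  obtain h where h: "bij_betw h {1..card F} F" using ex_bij_betw_nat_finite_1[OF \<open>finite F\<close>] by blast
  obtain x0 where x0: "x0 \<in> F" using assms by auto
  define x where "x i = (if i \<le> card F then h i else x0)" for i
  have xF: "x i \<in> F" if "i \<in> {1..n}" for i
    using that h x0 by (auto simp: x_def bij_betw_def)
  have "F \<subseteq> x ` {1..n}"
  proof
    fix y assume "y \<in> F"
    then obtain i where "i \<in> {1..card F}" "y = h i" using bij_betw_imp_surj_on[OF h] by blast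
    then show "y \<in> x ` {1..n}" using assms(4) by (auto simp: x_def intro!: image_eqI[of _ _ i])
  qed
  then have "(\<Union>y\<in>F. mcball y \<epsilon>) \<subseteq> (\<Union>i\<in>{1..n}. mcball (x i) \<epsilon>)" by blast
  then have "A \<subseteq> (\<Union>i\<in>{1..n}. mcball (x i) \<epsilon>)" using assms(6) by (rule order_trans[rotated])
  then have "\<epsilon> \<in> {\<epsilon>. 0 \<le> \<epsilon> \<and> (\<exists>x :: nat \<Rightarrow> 'a. (\<forall>i\<in>{1..n}. x i \<in> M) \<and> A \<subseteq> (\<Union>i\<in>{1..n}. mcball (x i) \<epsilon>))}"
    using xF assms(1,5) by (intro CollectI conjI exI[of _ x]) auto
  then show ?thesis unfolding entropy_number_def by (rule cInf_lower) (rule bdd_belowI[of _ 0], auto)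
qed

lemma entropy_number_ge:
  assumes "x0 \<in> M" "A \<subseteq> mcball x0 R" "1 \<le> n"
    and "\<And>\<epsilon> F. 0 \<le> \<epsilon> \<Longrightarrow> finite F \<Longrightarrow> card F \<le> n \<Longrightarrow> F \<subseteq> M \<Longrightarrow> A \<subseteq> (\<Union>x\<in>F. mcball x \<epsilon>) \<Longrightarrow> c \<le> \<epsilon>"
  shows "c \<le> entropy_number M d n A"
  unfolding entropy_number_def
proof (rule cInf_greatest[OF entropy_cover_exists[OF assms(1-3)]], clarify)
  fix \<epsilon> x assume *: "0 \<le> \<epsilon>" "\<forall>i\<in>{1..n}. x i \<in> M" "A \<subseteq> (\<Union>i\<in>{1..n}. mcball (x i) \<epsilon>)"
  show "c \<le> \<epsilon>"
    by (rule assms(4)[of \<epsilon> "x ` {1..n}"]) (use * card_image_le[of "{1..n}" x] in auto)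
qed

lemma entropy_number_nonneg:
  assumes "x0 \<in> M" "A \<subseteq> mcball x0 R" "1 \<le> n"
  shows "0 \<le> entropy_number M d n A"
  using assms by (rule entropy_number_ge)

lemma entropy_number_mono:
  assumes "x0 \<in> M" "A \<subseteq> mcball x0 R" "1 \<le> m" "m \<le> n"
  shows "entropy_number M d n A \<le> entropy_number M d m A"
proof (rule entropy_number_ge[OF assms(1-3)])
  fix \<epsilon> F assume *: "0 \<le> \<epsilon>" "finite F" "card F \<le> m" "F \<subseteq> M" "A \<subseteq> (\<Union>x\<in>F. mcball x \<epsilon>)"
  show "entropy_number M d n A \<le> \<epsilon>"
  proof (cases "F = {}")
    case True
    then have "A \<subseteq> (\<Union>x\<in>{x0}. mcball x \<epsilon>)" using * by auto
    then show ?thesis using assms * by (intro entropy_number_le[of _ "{x0}"]) auto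
  next
    case False
    then show ?thesis using assms * by (intro entropy_number_le[of _ F]) auto
  qed
qed

lemma entropy_number_less_imp_cover:
  assumes "x0 \<in> M" "A \<subseteq> mcball x0 R" "1 \<le> n" "entropy_number M d n A < \<epsilon>"
  obtains F where "finite F" "card F \<le> n" "F \<subseteq> M" "A \<subseteq> (\<Union>x\<in>F. mcball x \<epsilon>)"
proof -
  obtain \<delta> where \<delta>: "\<delta> < \<epsilon>" and "\<delta> \<in> {\<epsilon>. 0 \<le> \<epsilon> \<and> (\<exists>x :: nat \<Rightarrow> 'a. (\<forall>i\<in>{1..n}. x i \<in> M) \<and> A \<subseteq> (\<Union>i\<in>{1..n}. mcball (x i) \<epsilon>))}"
    using cInf_lessD[OF entropy_cover_exists[OF assms(1-3)] assms(4)[unfolded entropy_number_def]] by (elim bexE)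
  then obtain x where x: "\<delta> < \<epsilon>" "\<forall>i\<in>{1..n}. x i \<in> M" "A \<subseteq> (\<Union>i\<in>{1..n}. mcball (x i) \<delta>)"
    by (elim CollectE conjE exE)
  have "mcball y \<delta> \<subseteq> mcball y \<epsilon>" for y using x(1) by (intro mcball_subset_concentric) auto
  then have "(\<Union>i\<in>{1..n}. mcball (x i) \<delta>) \<subseteq> (\<Union>y\<in>x ` {1..n}. mcball y \<epsilon>)" by (simp add: UN_mono)
  then have "A \<subseteq> (\<Union>y\<in>x ` {1..n}. mcball y \<epsilon>)" using x(3) by (rule order_trans[rotated])
  then show ?thesis using x card_image_le[of "{1..n}" x] by (intro that[of "x ` {1..n}"]) auto
qed

lemma dyadic_entropy_nonneg:
  assumes "x0 \<in> M" "A \<subseteq> mcball x0 R"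
  shows "0 \<le> dyadic_entropy_number M d A n"
  unfolding dyadic_entropy_number_def by (rule entropy_number_nonneg[OF assms]) simp

lemma dyadic_entropy_antimono:
  assumes "x0 \<in> M" "A \<subseteq> mcball x0 R"
  shows "antimono_on {1..} (dyadic_entropy_number M d A)"
  unfolding dyadic_entropy_number_def
  by (intro monotone_onI entropy_number_mono[OF assms] power_increasing) auto

end

text \<open>
  In contrast to the definition of entropy numbers the centres form a set, possibly empty, of
  bounded cardinality; this is stable under images and products.
\<close>

definition ball_cover :: "'a::metric_space set \<Rightarrow> nat \<Rightarrow> real \<Rightarrow> bool" where
  "ball_cover S n \<epsilon> \<longleftrightarrow> (\<exists>F. finite F \<and> card F \<le> n \<and> S \<subseteq> (\<Union>x\<in>F. cball x \<epsilon>))"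

lemma ball_cover_mono:
  assumes "ball_cover S n \<epsilon>" "T \<subseteq> S" "n \<le> m" "\<epsilon> \<le> \<delta>"
  shows "ball_cover T m \<delta>"
proof -
  obtain F where "finite F" "card F \<le> n" "S \<subseteq> (\<Union>x\<in>F. cball x \<epsilon>)" using assms(1) unfolding ball_cover_def by blast
  moreover have "(\<Union>x\<in>F. cball x \<epsilon>) \<subseteq> (\<Union>x\<in>F. cball x \<delta>)" using assms(4) by (intro UN_mono subset_cball) auto
  ultimately show ?thesis unfolding ball_cover_def using assms(2,3) by (meson order_trans)
qed

lemma ball_cover_set_plus:
  fixes S T :: "'a::real_normed_vector set"
  assumes "ball_cover S n a" "ball_cover T m b"
  shows "ball_cover (S + T) (n * m) (a + b)"
proof -
  obtain F G where F: "finite F" "card F \<le> n" "S \<subseteq> (\<Union>x\<in>F. cball x a)"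
    and G: "finite G" "card G \<le> m" "T \<subseteq> (\<Union>x\<in>G. cball x b)"
    using assms unfolding ball_cover_def by blast
  show ?thesis unfolding ball_cover_def
  proof (intro exI[of _ "(\<lambda>(x, y). x + y) ` (F \<times> G)"] conjI)
    show "card ((\<lambda>(x, y). x + y) ` (F \<times> G)) \<le> n * m"
      using F G card_image_le[of "F \<times> G" "\<lambda>(x, y). x + y"]
      by (auto simp: card_cartesian_product intro: order_trans mult_le_mono)
    show "S + T \<subseteq> (\<Union>x\<in>(\<lambda>(x, y). x + y) ` (F \<times> G). cball x (a + b))"
    proof
      fix z assume "z \<in> S + T"
      then obtain s t where z: "z = s + t" "s \<in> S" "t \<in> T" by (auto elim: set_plus_elim)
      obtain x y where "x \<in> F" "y \<in> G" "dist x s \<le> a" "dist y t \<le> b"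
        using F(3) G(3) z by (fastforce simp: mem_cball)
      then have "x + y \<in> (\<lambda>(x, y). x + y) ` (F \<times> G)" "z \<in> cball (x + y) (a + b)"
        using dist_triangle_add[of x y s t] by (auto simp: z(1))
      then show "z \<in> (\<Union>x\<in>(\<lambda>(x, y). x + y) ` (F \<times> G). cball x (a + b))" by blast
    qed
  qed (use F G in auto)
qed

lemma absolutely_convex_aco: "absolutely_convex (aco A)"
  unfolding aco_def by (rule hull_in) (force simp: absolutely_convex_def)

lemma subset_aco: "A \<subseteq> aco A"
  unfolding aco_def by (rule hull_subset)

lemma aco_minimal: "A \<subseteq> S \<Longrightarrow> absolutely_convex S \<Longrightarrow> aco A \<subseteq> S"
  unfolding aco_def by (rule hull_minimal)

lemma absolutely_convex_cball: "absolutely_convex (cball (0::'a::real_normed_vector) R)"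
proof (unfold absolutely_convex_def, intro ballI allI impI)
  fix x y :: 'a and a b :: real
  assume xy: "x \<in> cball 0 R" "y \<in> cball 0 R" and ab: "\<bar>a\<bar> + \<bar>b\<bar> \<le> 1"
  have "norm (a *\<^sub>R x + b *\<^sub>R y) \<le> \<bar>a\<bar> * norm x + \<bar>b\<bar> * norm y"
    by (metis norm_scaleR norm_triangle_ineq)
  also have "\<dots> \<le> \<bar>a\<bar> * R + \<bar>b\<bar> * R" using xy by (intro add_mono mult_left_mono) auto
  also have "\<dots> \<le> 1 * R" unfolding distrib_right[symmetric]
    using ab xy norm_ge_zero[of x] by (intro mult_right_mono) (auto simp del: norm_ge_zero)
  finally show "a *\<^sub>R x + b *\<^sub>R y \<in> cball 0 R" by simp
qed

text \<open>
  This allows the absolutely convex hull to be split along a decomposition of the points of the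
  generating set, without ever writing a point of the hull as a combination.
\<close>

lemma absolutely_convex_set_plus:
  assumes "absolutely_convex S" "absolutely_convex T"
  shows "absolutely_convex (S + T)"
proof (unfold absolutely_convex_def, intro ballI allI impI)
  fix x y a b assume "x \<in> S + T" "y \<in> S + T" and ab: "\<bar>a\<bar> + \<bar>b\<bar> \<le> (1::real)"
  then obtain x1 x2 y1 y2 where "x = x1 + x2" "y = y1 + y2" "x1 \<in> S" "x2 \<in> T" "y1 \<in> S" "y2 \<in> T"
    by (auto elim!: set_plus_elim)
  moreover from this have "(a *\<^sub>R x1 + b *\<^sub>R y1) + (a *\<^sub>R x2 + b *\<^sub>R y2) \<in> S + T"
    using assms ab unfolding absolutely_convex_def by (intro set_plus_intro) auto
  ultimately show "a *\<^sub>R x + b *\<^sub>R y \<in> S + T" by (simp add: scaleR_add_right algebra_simps)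
qed

text \<open>
  Adding negatives and the origin turns absolutely convex combinations into convex ones, so that
  the description of the convex hull of a finite set applies.
\<close>

definition symmetrized :: "'a::real_vector set \<Rightarrow> 'a set" where
  "symmetrized D = insert 0 (D \<union> uminus ` D)"

lemma finite_symmetrized: "finite D \<Longrightarrow> finite (symmetrized D)"
  by (simp add: symmetrized_def)

lemma card_symmetrized: "finite D \<Longrightarrow> card (symmetrized D) \<le> 2 * card D + 1"
  unfolding symmetrized_def
  using card_insert_le_m1[of "Suc (2 * card D)" "D \<union> uminus ` D" 0] card_Un_le[of D "uminus ` D"] card_image_le[of D uminus]
  by fastforce

lemma absolutely_convex_hull_symmetrized: "absolutely_convex (convex hull (symmetrized D))"
proof -
  define H where "H = convex hull (symmetrized D)"
  have conv: "convex H" and z: "0 \<in> H"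
    by (auto simp: H_def symmetrized_def intro: hull_inc)
  have "uminus ` H = convex hull (uminus ` symmetrized D)"
    unfolding H_def by (rule convex_hull_linear_image[OF linearI]) auto
  also have "uminus ` symmetrized D = symmetrized D"
    by (auto simp: symmetrized_def image_Un image_image)
  finally have neg: "- x \<in> H" if "x \<in> H" for x using that by (auto simp: H_def)
  have sgn: "sgn c *\<^sub>R x \<in> H" if "x \<in> H" for x and c :: real
    using that neg z by (cases "c = 0"; cases "0 < c") auto
  show ?thesis unfolding absolutely_convex_def H_def[symmetric]
  proof (intro ballI allI impI)
    fix x y and a b :: real assume *: "x \<in> H" "y \<in> H" "\<bar>a\<bar> + \<bar>b\<bar> \<le> 1"
    show "a *\<^sub>R x + b *\<^sub>R y \<in> H"
    proof (cases "a = 0 \<and> b = 0")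
      case False
      define c where "c = \<bar>a\<bar> + \<bar>b\<bar>"
      have c: "0 < c" "c \<le> 1" using False *(3) by (auto simp: c_def)
      have "(\<bar>a\<bar> / c) *\<^sub>R (sgn a *\<^sub>R x) + (\<bar>b\<bar> / c) *\<^sub>R (sgn b *\<^sub>R y) \<in> H"
        using c sgn * by (intro convexD[OF conv]) (auto simp: c_def add_divide_distrib[symmetric])
      then have "(1 - c) *\<^sub>R 0 + c *\<^sub>R ((\<bar>a\<bar> / c) *\<^sub>R (sgn a *\<^sub>R x) + (\<bar>b\<bar> / c) *\<^sub>R (sgn b *\<^sub>R y)) \<in> H"
        using c by (intro convexD_alt[OF conv z]) auto
      then show ?thesis using c by (simp add: scaleR_add_right abs_mult_sgn)
    qed (use z in simp)
  qed
qed

lemma aco_subset_hull_symmetrized: "aco D \<subseteq> convex hull (symmetrized D)"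
  by (rule aco_minimal[OF _ absolutely_convex_hull_symmetrized])
    (use hull_subset[of "symmetrized D" convex] in \<open>auto simp: symmetrized_def\<close>)

lemma rounding_error:
  fixes c u M :: real
  assumes "0 < M" "c \<le> u * M" "u * M \<le> c + 1"
  shows "\<bar>c / M - u\<bar> \<le> 1 / M"
proof -
  have "c / M \<le> u" using assms(1,2) by (simp add: pos_divide_le_eq)
  moreover have "u \<le> (c + 1) / M" using assms(1,3) by (simp add: pos_le_divide_eq)
  ultimately show ?thesis by (simp add: add_divide_distrib)
qed

text \<open>
  Rounding every barycentric coordinate down to a multiple of \<open>1 / L\<close> moves the point by at most
  \<open>R / L\<close> per vertex. The number of centres is exponential in \<open>card E\<close>, so this serves
  only for small vertex sets.
\<close>

lemma grid_cover:
  fixes E :: "'a::real_normed_vector set"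
  assumes E: "finite E" and R: "\<And>v. v \<in> E \<Longrightarrow> norm v \<le> R" and L: "1 \<le> L"
  shows "ball_cover (convex hull E) ((L + 1) ^ card E) (real (card E) * R / real L)"
  unfolding ball_cover_def
proof (intro exI[of _ "(\<lambda>g. \<Sum>v\<in>E. (real (g v) / real L) *\<^sub>R v) ` (E \<rightarrow>\<^sub>E {..L})"] conjI)
  show "finite ((\<lambda>g. \<Sum>v\<in>E. (real (g v) / real L) *\<^sub>R v) ` (E \<rightarrow>\<^sub>E {..L}))"
    using E by (intro finite_imageI finite_PiE) auto
  show "card ((\<lambda>g. \<Sum>v\<in>E. (real (g v) / real L) *\<^sub>R v) ` (E \<rightarrow>\<^sub>E {..L})) \<le> (L + 1) ^ card E"
    using card_image_le[of "E \<rightarrow>\<^sub>E {..L}" "\<lambda>g. \<Sum>v\<in>E. (real (g v) / real L) *\<^sub>R v"] E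
    by (simp add: card_PiE finite_PiE)
  show "convex hull E \<subseteq> (\<Union>x\<in>(\<lambda>g. \<Sum>v\<in>E. (real (g v) / real L) *\<^sub>R v) ` (E \<rightarrow>\<^sub>E {..L}).
      cball x (real (card E) * R / real L))"
  proof
    fix x assume "x \<in> convex hull E"
    then obtain u where u: "\<And>v. v \<in> E \<Longrightarrow> 0 \<le> u v" "sum u E = 1" "x = (\<Sum>v\<in>E. u v *\<^sub>R v)"
      unfolding convex_hull_finite[OF E] by blast
    have u1: "u v \<le> 1" if "v \<in> E" for v using member_le_sum[of v E u] u that E by auto
    define g where "g = restrict (\<lambda>v. nat \<lfloor>u v * real L\<rfloor>) E"
    have "g \<in> E \<rightarrow>\<^sub>E {..L}"
    proof -
      have "nat \<lfloor>u v * real L\<rfloor> \<le> L" if "v \<in> E" for v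
        using mult_right_mono[OF u1[OF that], of "real L"] by (simp add: nat_le_iff floor_le_iff)
      then show ?thesis by (auto simp: g_def)
    qed
    moreover have "norm ((\<Sum>v\<in>E. (real (g v) / real L) *\<^sub>R v) - x) \<le> (\<Sum>v\<in>E. R / real L)"
      unfolding u(3) sum_subtractf[symmetric] scaleR_diff_left[symmetric]
    proof (rule sum_norm_le)
      fix v assume v: "v \<in> E"
      have "real (nat \<lfloor>u v * real L\<rfloor>) \<le> u v * real L" "u v * real L \<le> real (nat \<lfloor>u v * real L\<rfloor>) + 1"
        using u(1)[OF v] by (auto simp: of_nat_nat)
      then have "\<bar>real (g v) / real L - u v\<bar> \<le> 1 / real L"
        using v L unfolding g_def by (simp only: restrict_apply' if_True, intro rounding_error) auto
      then have "\<bar>real (g v) / real L - u v\<bar> * norm v \<le> 1 / real L * R"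
        using R[OF v] by (intro mult_mono) auto
      then show "norm ((real (g v) / real L - u v) *\<^sub>R v) \<le> R / real L" by simp
    qed
    ultimately show "x \<in> (\<Union>x\<in>(\<lambda>g. \<Sum>v\<in>E. (real (g v) / real L) *\<^sub>R v) ` (E \<rightarrow>\<^sub>E {..L}).
      cball x (real (card E) * R / real L))"
      by (auto simp: dist_norm intro!: bexI[of _ g])
  qed
qed

text \<open>
  A normed space need not be second countable, so sums of vector-valued measurable
  functions are avoided: the claim is proved by splitting according to the sign of one Rademacher
  function at a time, with a free translation \<open>y\<close> absorbing the vectors already treated.
\<close>

lemma rademacher_sum_measurable:
  fixes x :: "nat \<Rightarrow> 'a::real_normed_vector"
  shows "(\<lambda>t. norm (y + (\<Sum>i=1..k. rademacher i t *\<^sub>R x i))) \<in> borel_measurable borel"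
proof (induction k arbitrary: y)
  case (Suc k)
  have eq: "(\<lambda>t. norm (y + (\<Sum>i=1..Suc k. rademacher i t *\<^sub>R x i))) =
    (\<lambda>t. if 0 < sin (2 ^ Suc k * pi * t) then norm ((y + x (Suc k)) + (\<Sum>i=1..k. rademacher i t *\<^sub>R x i))
         else if sin (2 ^ Suc k * pi * t) < 0 then norm ((y - x (Suc k)) + (\<Sum>i=1..k. rademacher i t *\<^sub>R x i))
         else norm (y + (\<Sum>i=1..k. rademacher i t *\<^sub>R x i)))"
    by (auto simp: fun_eq_iff rademacher_def algebra_simps)
  have "Measurable.pred borel (\<lambda>t. 0 < sin (2 ^ Suc k * pi * t))" "Measurable.pred borel (\<lambda>t. sin (2 ^ Suc k * pi * t) < 0)"
    by (auto simp: pred_def intro!: open_Collect_less borel_open continuous_intros)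
  then show ?case unfolding eq by (intro measurable_If Suc.IH predE)
qed simp

lemma rademacher_sum_integrable:
  fixes x :: "nat \<Rightarrow> 'a::real_normed_vector"
  shows "(\<lambda>t. norm (\<Sum>i=1..k. rademacher i t *\<^sub>R x i)) integrable_on {0..1}"
proof (rule measurable_bounded_by_integrable_imp_integrable_real)
  have "(\<lambda>t. norm (\<Sum>i=1..k. rademacher i t *\<^sub>R x i)) \<in> borel_measurable lborel"
    using rademacher_sum_measurable[of 0] by simp
  then show "(\<lambda>t. norm (\<Sum>i=1..k. rademacher i t *\<^sub>R x i)) \<in> borel_measurable (lebesgue_on {0..1})"
    by (intro measurable_restrict_space1 measurable_completion)
  show "(\<lambda>t. \<Sum>i=1..k. norm (x i)) integrable_on {0..1::real}" by (rule integrable_const_ivl)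
  fix t :: real
  show "\<bar>norm (\<Sum>i=1..k. rademacher i t *\<^sub>R x i)\<bar> \<le> (\<Sum>i=1..k. norm (x i))"
    unfolding abs_norm_cancel
  proof (rule sum_norm_le)
    have "\<bar>rademacher i t\<bar> \<le> 1" for i by (simp add: rademacher_def sgn_if)
    then show "norm (rademacher i t *\<^sub>R x i) \<le> norm (x i)" for i
      by (simp add: mult_left_le_one_le)
  qed
qed auto

lemma negligible_rademacher_zeros: "negligible {t. \<exists>i. rademacher i t = 0}"
proof -
  have "{t. \<exists>i. rademacher i t = 0} \<subseteq> (\<lambda>(m::int, i::nat). real_of_int m / 2 ^ i) ` UNIV"
  proof clarify
    fix t i assume "rademacher i t = 0"
    then obtain m :: int where "2 ^ i * pi * t = of_int m * pi"
      by (auto simp: rademacher_def sgn_zero_iff sin_zero_iff_int2)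
    then have "t = real_of_int m / 2 ^ i" by (simp add: field_simps)
    then show "t \<in> (\<lambda>(m::int, i::nat). real_of_int m / 2 ^ i) ` UNIV" by (auto intro!: image_eqI[of _ _ "(m, i)"])
  qed
  then have "countable {t. \<exists>i. rademacher i t = 0}" by (rule countable_subset) auto
  then show ?thesis by (simp add: negligible_iff_null_sets null_sets_completionI countable_imp_null_set_lborel)
qed

text \<open>
  The norm in the integral equals that of a signed sum for almost every \<open>t\<close>, hence the
  integral is at least the minimum over all choices of signs. Integrability matters here, because
  the integral of a non-integrable function is \<open>0\<close> by convention.
\<close>

lemma of_type_signs_seq:
  fixes x :: "nat \<Rightarrow> 'a::real_normed_vector"
  assumes "integral {0..1} (\<lambda>t. norm (\<Sum>i=1..k. rademacher i t *\<^sub>R x i)) \<le> B"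
  shows "\<exists>\<epsilon>. (\<forall>i. \<epsilon> i = 1 \<or> \<epsilon> i = - 1) \<and> norm (\<Sum>i=1..k. \<epsilon> i *\<^sub>R x i) \<le> B"
proof (rule ccontr)
  assume contr: "\<not> ?thesis"
  define S where "S = {1..k} \<rightarrow>\<^sub>E {1, - 1 :: real}"
  have S: "finite S" "S \<noteq> {}" by (auto simp: S_def finite_PiE PiE_eq_empty_iff)
  define \<mu> where "\<mu> = Min ((\<lambda>\<epsilon>. norm (\<Sum>i=1..k. \<epsilon> i *\<^sub>R x i)) ` S)"
  have "\<mu> \<in> (\<lambda>\<epsilon>. norm (\<Sum>i=1..k. \<epsilon> i *\<^sub>R x i)) ` S"
    unfolding \<mu>_def using S by (intro Min_in) auto
  then obtain \<epsilon> where \<epsilon>: "\<epsilon> \<in> S" "\<mu> = norm (\<Sum>i=1..k. \<epsilon> i *\<^sub>R x i)" by blast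
  have "\<not> norm (\<Sum>i=1..k. (if i \<in> {1..k} then \<epsilon> i else 1) *\<^sub>R x i) \<le> B"
    using contr[unfolded not_ex, rule_format, of "\<lambda>i. if i \<in> {1..k} then \<epsilon> i else 1"] \<epsilon>(1)
    by (simp only: de_Morgan_conj) (fastforce simp: S_def PiE_iff)
  moreover have "(\<Sum>i=1..k. (if i \<in> {1..k} then \<epsilon> i else 1) *\<^sub>R x i) = (\<Sum>i=1..k. \<epsilon> i *\<^sub>R x i)"
    by (rule sum.cong) auto
  ultimately have \<mu>B: "B < \<mu>" using \<epsilon>(2) by simp
  define f where "f t = norm (\<Sum>i=1..k. rademacher i t *\<^sub>R x i)" for t
  have ge: "\<mu> \<le> f t" if "t \<notin> {t. \<exists>i. rademacher i t = 0}" for t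
  proof -
    have "(\<lambda>i\<in>{1..k}. rademacher i t) \<in> S"
      using that by (auto simp: S_def rademacher_def sgn_if split: if_splits)
    then have "\<mu> \<le> norm (\<Sum>i=1..k. (\<lambda>i\<in>{1..k}. rademacher i t) i *\<^sub>R x i)"
      unfolding \<mu>_def using S by (intro Min_le finite_imageI imageI)
    then show ?thesis unfolding f_def by simp
  qed
  \<comment> \<open>Outside the zeros of the Rademacher functions the maximum changes nothing, and it turns the
     bound almost everywhere into a bound everywhere.\<close>
  have eq: "integral {0..1} f = integral {0..1} (\<lambda>t. max \<mu> (f t))"
    by (rule integral_spike[OF negligible_rademacher_zeros]) (use ge in force)
  have "(\<lambda>t. max \<mu> (f t)) integrable_on {0..1}"
    by (rule integrable_spike[OF _ negligible_rademacher_zeros, of f])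
      (use ge rademacher_sum_integrable[of x k] in \<open>auto simp: f_def[abs_def] max_def\<close>)
  then have "integral {0..1::real} (\<lambda>t. \<mu>) \<le> integral {0..1} (\<lambda>t. max \<mu> (f t))"
    by (intro integral_le) auto
  then show False using assms \<mu>B eq unfolding f_def by simp
qed

text \<open>
  The form in which type \<open>p\<close> is used: an arbitrary finite index set, vectors of norm at most
  \<open>\<delta>\<close>, and one good choice of signs instead of an average over all of them.
\<close>

lemma of_type_signs:
  assumes "of_type TYPE('a::real_normed_vector) p"
  obtains \<rho> where "0 < \<rho>"
    "\<And>(I :: 'i set) (v :: 'i \<Rightarrow> 'a) \<delta>. finite I \<Longrightarrow> (\<And>i. i \<in> I \<Longrightarrow> norm (v i) \<le> \<delta>) \<Longrightarrow> 0 \<le> \<delta> \<Longrightarrow>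
      \<exists>\<epsilon>. (\<forall>i\<in>I. \<epsilon> i = 1 \<or> \<epsilon> i = - 1) \<and> norm (\<Sum>i\<in>I. \<epsilon> i *\<^sub>R v i) \<le> \<rho> * \<delta> * real (card I) powr (1/p)"
proof -
  obtain \<rho> where p: "1 \<le> p" and \<rho>: "0 < \<rho>"
    and type: "\<And>k (x :: nat \<Rightarrow> 'a). integral {0..1} (\<lambda>t. norm (\<Sum>i=1..k. rademacher i t *\<^sub>R x i))
          \<le> \<rho> * (\<Sum>i=1..k. norm (x i) powr p) powr (1/p)"
    using assms unfolding of_type_def by blast
  show ?thesis
  proof (rule that[OF \<rho>])
    fix I :: "'i set" and v :: "'i \<Rightarrow> 'a" and \<delta>
    assume I: "finite I" and v: "\<And>i. i \<in> I \<Longrightarrow> norm (v i) \<le> \<delta>" and \<delta>: "0 \<le> \<delta>"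
    obtain h where h: "bij_betw h {1..card I} I" using ex_bij_betw_nat_finite_1[OF I] by blast
    define x where "x = v \<circ> h"
    have hI: "h i \<in> I" if "i \<in> {1..card I}" for i using h that by (auto simp: bij_betw_def)
    have "(\<Sum>i=1..card I. norm (x i) powr p) \<le> (\<Sum>i=1..card I. \<delta> powr p)"
      using v[OF hI] p by (intro sum_mono powr_mono2) (auto simp: x_def)
    then have "(\<Sum>i=1..card I. norm (x i) powr p) powr (1/p) \<le> (real (card I) * \<delta> powr p) powr (1/p)"
      using p by (intro powr_mono2) (auto intro: sum_nonneg)
    also have "\<dots> = \<delta> * real (card I) powr (1/p)"
      using p \<delta> by (simp add: powr_mult powr_powr)
    finally have "\<rho> * (\<Sum>i=1..card I. norm (x i) powr p) powr (1/p) \<le> \<rho> * (\<delta> * real (card I) powr (1/p))"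
      using \<rho> by (intro mult_left_mono) auto
    from of_type_signs_seq[OF order_trans[OF type this]]
    obtain \<epsilon> where \<epsilon>: "\<forall>i. \<epsilon> i = 1 \<or> \<epsilon> i = - 1"
      "norm (\<Sum>i=1..card I. \<epsilon> i *\<^sub>R x i) \<le> \<rho> * \<delta> * real (card I) powr (1/p)"
      unfolding mult.assoc[symmetric] by (elim exE conjE)
    define g where "g = the_inv_into {1..card I} h"
    have "(\<Sum>i\<in>I. \<epsilon> (g i) *\<^sub>R v i) = (\<Sum>i=1..card I. \<epsilon> i *\<^sub>R x i)"
      using sum.reindex_bij_betw[OF h, of "\<lambda>i. \<epsilon> (g i) *\<^sub>R v i", symmetric] h
      by (simp add: x_def g_def the_inv_into_f_f bij_betw_def)
    then show "\<exists>\<epsilon>. (\<forall>i\<in>I. \<epsilon> i = 1 \<or> \<epsilon> i = - 1) \<and> norm (\<Sum>i\<in>I. \<epsilon> i *\<^sub>R v i) \<le> \<rho> * \<delta> * real (card I) powr (1/p)"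
      using \<epsilon> by (intro exI[of _ "\<epsilon> \<circ> g"]) auto
  qed
qed

text \<open>
  If \<open>P\<close> and \<open>Q\<close> are the classes of positive and negative signs, then
  \<open>\<Sum>\<^sub>I v - 2 \<Sum>\<^sub>P v = - (\<Sum>\<^sub>P v - \<Sum>\<^sub>Q v)\<close>, and similarly for \<open>Q\<close>. So replacing the sum by twice the sum
  over the smaller class costs only the small signed sum and at least halves the number of terms.
  Relative to the final weight \<open>2 ^ l\<close> the costs form a geometric series of ratio
  \<open>2 powr (1 / p - 1)\<close>.
\<close>

lemma sign_halving:
  fixes v :: "'i \<Rightarrow> 'a::real_normed_vector"
  assumes signs: "\<And>J. J \<subseteq> I \<Longrightarrow> \<exists>\<epsilon>. (\<forall>i\<in>J. \<epsilon> i = 1 \<or> \<epsilon> i = - 1) \<and>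
      norm (\<Sum>i\<in>J. \<epsilon> i *\<^sub>R v i) \<le> B * real (card J) powr (1/p)"
    and "0 \<le> B" "1 \<le> p" "finite I" "card I \<le> 2 ^ l * N"
  shows "\<exists>J\<subseteq>I. card J \<le> N \<and> norm ((\<Sum>i\<in>I. v i) - 2 ^ l *\<^sub>R (\<Sum>i\<in>J. v i)) \<le>
      2 ^ l * (B * real N powr (1/p) * (\<Sum>k=1..l. (2 powr (1/p - 1)) ^ k))"
  using assms(1,4,5)
proof (induction l arbitrary: I)
  case 0
  then show ?case by (intro exI[of _ I]) auto
next
  case (Suc l)
  define q :: real where "q = 2 powr (1/p - 1)"
  obtain \<epsilon> where \<epsilon>: "\<And>i. i \<in> I \<Longrightarrow> \<epsilon> i = 1 \<or> \<epsilon> i = - 1"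
    and B: "norm (\<Sum>i\<in>I. \<epsilon> i *\<^sub>R v i) \<le> B * real (card I) powr (1/p)" using Suc.prems(1) by blast
  define P where "P = {i\<in>I. \<epsilon> i = 1}"
  define Q where "Q = {i\<in>I. \<epsilon> i \<noteq> 1}"
  have PQ: "I = P \<union> Q" "P \<inter> Q = {}" "finite P" "finite Q" using Suc.prems(2) by (auto simp: P_def Q_def)
  have split: "(\<Sum>i\<in>I. f i) = (\<Sum>i\<in>P. f i) + (\<Sum>i\<in>Q. f i)" for f :: "'i \<Rightarrow> 'a"
    unfolding PQ(1) using PQ by (intro sum.union_disjoint) auto
  have "(\<Sum>i\<in>P. \<epsilon> i *\<^sub>R v i) = (\<Sum>i\<in>P. v i)" by (rule sum.cong) (auto simp: P_def)
  moreover have "(\<Sum>i\<in>Q. \<epsilon> i *\<^sub>R v i) = - (\<Sum>i\<in>Q. v i)"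
    unfolding sum_negf[symmetric] using \<epsilon> by (intro sum.cong) (force simp: Q_def)+
  ultimately have se: "(\<Sum>i\<in>I. \<epsilon> i *\<^sub>R v i) = (\<Sum>i\<in>P. v i) - (\<Sum>i\<in>Q. v i)"
    using split[of "\<lambda>i. \<epsilon> i *\<^sub>R v i"] by simp
  have "card I = card P + card Q" unfolding PQ(1) using PQ by (intro card_Un_disjoint)
  moreover have "2 ^ Suc l * N = 2 * (2 ^ l * N)" by simp
  ultimately have "card P \<le> 2 ^ l * N \<or> card Q \<le> 2 ^ l * N" using Suc.prems(3) by linarith
  then obtain J1 where J1: "J1 = P \<or> J1 = Q" "card J1 \<le> 2 ^ l * N" by blast
  have J1I: "J1 \<subseteq> I" "finite J1" using J1(1) PQ by auto
  have "(\<Sum>i\<in>I. v i) - 2 *\<^sub>R (\<Sum>i\<in>J1. v i) = (\<Sum>i\<in>I. \<epsilon> i *\<^sub>R v i) \<or>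
        (\<Sum>i\<in>I. v i) - 2 *\<^sub>R (\<Sum>i\<in>J1. v i) = - (\<Sum>i\<in>I. \<epsilon> i *\<^sub>R v i)"
    using J1(1) split[of v] se by (auto simp: scaleR_2)
  then have "norm ((\<Sum>i\<in>I. v i) - 2 *\<^sub>R (\<Sum>i\<in>J1. v i)) \<le> B * real (card I) powr (1/p)"
    using B by (elim disjE) (simp_all only: norm_minus_cancel)
  also have "\<dots> \<le> B * (2 ^ Suc l * real N) powr (1/p)"
  proof -
    have "real (card I) \<le> real (2 ^ Suc l * N)" using Suc.prems(3) by (simp only: of_nat_le_iff)
    then show ?thesis using assms(2,3) by (intro mult_left_mono powr_mono2) auto
  qed
  also have "\<dots> = 2 ^ Suc l * (B * real N powr (1/p) * q ^ Suc l)"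
  proof -
    have "(2 ^ Suc l) powr (1/p) = 2 ^ Suc l * q ^ Suc l"
      by (simp only: q_def powr_realpow[symmetric, of "2 powr (1/p - 1)"] powr_realpow[symmetric, of 2] powr_powr zero_less_numeral powr_gt_zero)
        (simp add: powr_add[symmetric] algebra_simps)
    then show ?thesis using powr_mult[of "2 ^ Suc l" "real N" "1/p"] by (simp add: mult_ac)
  qed
  finally have step: "norm ((\<Sum>i\<in>I. v i) - 2 *\<^sub>R (\<Sum>i\<in>J1. v i)) \<le> 2 ^ Suc l * (B * real N powr (1/p) * q ^ Suc l)" .
  obtain J where J: "J \<subseteq> J1" "card J \<le> N" and n: "norm ((\<Sum>i\<in>J1. v i) - 2 ^ l *\<^sub>R (\<Sum>i\<in>J. v i)) \<le>
      2 ^ l * (B * real N powr (1/p) * (\<Sum>k=1..l. q ^ k))"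
    using Suc.IH[of J1] Suc.prems(1) J1I J1(2) unfolding q_def by (meson order_trans)
  have "(\<Sum>i\<in>I. v i) - 2 ^ Suc l *\<^sub>R (\<Sum>i\<in>J. v i) =
      ((\<Sum>i\<in>I. v i) - 2 *\<^sub>R (\<Sum>i\<in>J1. v i)) + 2 *\<^sub>R ((\<Sum>i\<in>J1. v i) - 2 ^ l *\<^sub>R (\<Sum>i\<in>J. v i))"
    by (simp add: scaleR_diff_right)
  then have "norm ((\<Sum>i\<in>I. v i) - 2 ^ Suc l *\<^sub>R (\<Sum>i\<in>J. v i)) \<le>
      2 ^ Suc l * (B * real N powr (1/p) * q ^ Suc l) + 2 * (2 ^ l * (B * real N powr (1/p) * (\<Sum>k=1..l. q ^ k)))"
    by (simp only:) (intro norm_triangle_le add_mono step, use n in simp)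
  also have "\<dots> = 2 ^ Suc l * (B * real N powr (1/p) * (\<Sum>k=1..Suc l. q ^ k))"
    by (simp add: algebra_simps)
  finally show ?case unfolding q_def using J J1I by blast
qed

text \<open>
  Maurey's lemma. The barycentric coordinates of a point are rounded to multiples of
  \<open>1 / (2 ^ l * N)\<close>, with \<open>l\<close> so large that the rounding error is negligible; the numerators
  become multiplicities, and halving \<open>l\<close> times leaves at most \<open>N\<close> vectors with weight
  \<open>1 / N\<close> each. Shorter sums are padded with the origin, so that all centres are
  averages of lists of length exactly \<open>N\<close>.
\<close>

lemma maurey_cover:
  fixes p p' :: real
  assumes type: "of_type TYPE('a::real_normed_vector) p" and p: "1 < p" and pp: "1 / p + 1 / p' = 1"
  obtains C where "1 \<le> C" "\<And>(E :: 'a set) \<delta> N. finite E \<Longrightarrow> 0 \<in> E \<Longrightarrow> (\<And>v. v \<in> E \<Longrightarrow> norm v \<le> \<delta>) \<Longrightarrow> 1 \<le> N \<Longrightarrow>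
     ball_cover (convex hull E) (card E ^ N) (C * \<delta> * real N powr (- 1 / p'))"
proof -
  obtain \<rho> where \<rho>: "0 < \<rho>" and signs:
    "\<And>(I :: ('a \<times> nat) set) (v :: 'a \<times> nat \<Rightarrow> 'a) \<delta>. finite I \<Longrightarrow> (\<And>i. i \<in> I \<Longrightarrow> norm (v i) \<le> \<delta>) \<Longrightarrow> 0 \<le> \<delta> \<Longrightarrow>
      \<exists>\<epsilon>. (\<forall>i\<in>I. \<epsilon> i = 1 \<or> \<epsilon> i = - 1) \<and> norm (\<Sum>i\<in>I. \<epsilon> i *\<^sub>R v i) \<le> \<rho> * \<delta> * real (card I) powr (1/p)"
    using of_type_signs[OF type, where ?'i = "'a \<times> nat"] by blast
  define q :: real where "q = 2 powr (1/p - 1)"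
  have q: "0 < q" "q < 1" using p by (auto simp: q_def powr_less_one)
  have geo: "(\<Sum>k=1..l. q ^ k) \<le> 1 / (1 - q)" for l
  proof -
    have "(\<Sum>k=1..l. q ^ k) \<le> (\<Sum>k. q ^ k)" using q by (intro sum_le_suminf summable_geometric) auto
    also have "\<dots> = 1 / (1 - q)" using q by (simp add: suminf_geometric)
    finally show ?thesis .
  qed
  define C where "C = 1 + \<rho> / (1 - q)"
  show ?thesis
  proof (rule that)
    show "1 \<le> C" using \<rho> q by (simp add: C_def)
    fix E :: "'a set" and \<delta> and N :: nat
    assume E: "finite E" "0 \<in> E" and \<delta>: "\<And>v. v \<in> E \<Longrightarrow> norm v \<le> \<delta>" and N: "1 \<le> N"
    have \<delta>0: "0 \<le> \<delta>" using \<delta>[OF E(2)] by simp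
    define T where "T = {xs. set xs \<subseteq> E \<and> length xs = N}"
    have near: "\<exists>xs\<in>T. norm (x - (1 / real N) *\<^sub>R sum_list xs) \<le> C * \<delta> * real N powr (- 1 / p')"
      if x: "x \<in> convex hull E" for x
    proof -
      obtain u where u: "\<And>v. v \<in> E \<Longrightarrow> 0 \<le> u v" "sum u E = 1" "x = (\<Sum>v\<in>E. u v *\<^sub>R v)"
        using x unfolding convex_hull_finite[OF E(1)] by blast
      \<comment> \<open>With this \<open>l\<close> the total rounding error \<open>card E * \<delta> / M\<close> is at most \<open>\<delta> N powr (- 1 / p')\<close>.\<close>
      obtain l where l: "real (card E) / real N powr (- 1 / p') < 2 ^ l"
        using real_arch_pow[of 2] by auto
      define M where "M = 2 ^ l * N"
      have "2 ^ l \<le> real M" "0 < real M" using N by (auto simp: M_def)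
      define w where "w = real N powr (- 1 / p')"
      have "0 < w" using N by (simp add: w_def)
      have "real (card E) / w \<le> real M" using less_imp_le[OF less_le_trans[OF l \<open>2 ^ l \<le> real M\<close>]] by (simp only: w_def)
      then have EM: "real (card E) / real M \<le> real N powr (- 1 / p')"
        unfolding w_def[symmetric] using \<open>0 < w\<close> \<open>0 < real M\<close> by (simp add: pos_divide_le_eq mult.commute)
      define c where "c v = nat \<lfloor>u v * real M\<rfloor>" for v
      have c: "real (c v) \<le> u v * real M" "u v * real M \<le> real (c v) + 1" if "v \<in> E" for v
        using u(1)[OF that] unfolding c_def by (auto simp: of_nat_nat)
      define I where "I = Sigma E (\<lambda>v. {..<c v})"
      have I: "finite I" using E by (auto simp: I_def)
      have "real (card I) = (\<Sum>v\<in>E. real (c v))" using E by (simp add: I_def)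
      also have "\<dots> \<le> (\<Sum>v\<in>E. u v * real M)" by (intro sum_mono c)
      also have "\<dots> = real M" by (simp add: sum_distrib_right[symmetric] u)
      finally have cardI: "card I \<le> 2 ^ l * N" unfolding M_def by (simp only: of_nat_le_iff)
      have sumI: "(\<Sum>i\<in>I. fst i) = (\<Sum>v\<in>E. real (c v) *\<^sub>R v)"
      proof -
        have "(\<Sum>i\<in>I. fst i) = (\<Sum>(v, k)\<in>Sigma E (\<lambda>v. {..<c v}). v)" by (simp add: I_def split_def)
        also have "\<dots> = (\<Sum>v\<in>E. \<Sum>k<c v. v)" using E by (intro sum.Sigma[symmetric]) auto
        finally show ?thesis by (simp add: sum_constant_scaleR)
      qed
      have "\<exists>J\<subseteq>I. card J \<le> N \<and> norm ((\<Sum>i\<in>I. fst i) - 2 ^ l *\<^sub>R (\<Sum>i\<in>J. fst i)) \<le>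
          2 ^ l * (\<rho> * \<delta> * real N powr (1/p) * (\<Sum>k=1..l. (2 powr (1/p - 1)) ^ k))"
      proof (rule sign_halving[OF _ _ _ I cardI])
        fix J assume J: "J \<subseteq> I"
        show "\<exists>\<epsilon>. (\<forall>i\<in>J. \<epsilon> i = 1 \<or> \<epsilon> i = - 1) \<and> norm (\<Sum>i\<in>J. \<epsilon> i *\<^sub>R fst i) \<le> \<rho> * \<delta> * real (card J) powr (1/p)"
          using J I \<delta> \<delta>0 by (intro signs) (auto simp: I_def intro: finite_subset)
      qed (use \<rho> \<delta>0 p in auto)
      then obtain J where J: "J \<subseteq> I" "card J \<le> N" and nJ: "norm ((\<Sum>i\<in>I. fst i) - 2 ^ l *\<^sub>R (\<Sum>i\<in>J. fst i)) \<le>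
          2 ^ l * (\<rho> * \<delta> * real N powr (1/p) * (\<Sum>k=1..l. q ^ k))" unfolding q_def by blast
      obtain ys where ys: "set ys = J" "distinct ys" using finite_distinct_list[of J] J I finite_subset by blast
      define xs where "xs = map fst ys @ replicate (N - length ys) 0"
      have "length ys = card J" using ys distinct_card by fastforce
      then have xsT: "xs \<in> T" using J ys E by (auto simp: T_def xs_def I_def)
      have sl: "sum_list xs = (\<Sum>i\<in>J. fst i)"
      proof -
        have "sum_list (replicate m (0::'a)) = 0" for m by (induction m) auto
        then show ?thesis using ys by (simp add: xs_def sum_list_distinct_conv_sum_set)
      qed
      have e1: "norm (x - (1 / real M) *\<^sub>R (\<Sum>i\<in>I. fst i)) \<le> real (card E) * (\<delta> / real M)"
      proof -
        have "x - (1 / real M) *\<^sub>R (\<Sum>i\<in>I. fst i) = (\<Sum>v\<in>E. (u v - real (c v) / real M) *\<^sub>R v)"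
          unfolding sumI u(3) by (simp add: scaleR_sum_right sum_subtractf scaleR_diff_left)
        also have "norm \<dots> \<le> (\<Sum>v\<in>E. \<delta> / real M)"
        proof (rule sum_norm_le)
          fix v assume v: "v \<in> E"
          have "\<bar>u v - real (c v) / real M\<bar> \<le> 1 / real M"
            using rounding_error[OF \<open>0 < real M\<close> c[OF v]] by (simp only: abs_minus_commute)
          then have "\<bar>u v - real (c v) / real M\<bar> * norm v \<le> 1 / real M * \<delta>"
            using \<delta>[OF v] by (intro mult_mono) auto
          then show "norm ((u v - real (c v) / real M) *\<^sub>R v) \<le> \<delta> / real M" by simp
        qed
        finally show ?thesis by simp
      qed
      have e2: "norm ((1 / real M) *\<^sub>R (\<Sum>i\<in>I. fst i) - (1 / real N) *\<^sub>R sum_list xs) \<le>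
          \<rho> * \<delta> * real N powr (- 1 / p') * (1 / (1 - q))"
      proof -
        have M: "1 / real M * 2 ^ l = 1 / real N" by (simp add: M_def)
        have "(1 / real M) *\<^sub>R (\<Sum>i\<in>I. fst i) - (1 / real N) *\<^sub>R sum_list xs =
          (1 / real M) *\<^sub>R ((\<Sum>i\<in>I. fst i) - 2 ^ l *\<^sub>R (\<Sum>i\<in>J. fst i))"
          unfolding sl scaleR_diff_right scaleR_scaleR M ..
        then have "norm ((1 / real M) *\<^sub>R (\<Sum>i\<in>I. fst i) - (1 / real N) *\<^sub>R sum_list xs) =
           1 / real M * norm ((\<Sum>i\<in>I. fst i) - 2 ^ l *\<^sub>R (\<Sum>i\<in>J. fst i))" by simp
        also have "\<dots> \<le> 1 / real M * (2 ^ l * (\<rho> * \<delta> * real N powr (1/p) * (\<Sum>k=1..l. q ^ k)))"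
          using nJ by (rule mult_left_mono) simp
        also have "\<dots> = \<rho> * \<delta> * (real N powr (1/p) / real N) * (\<Sum>k=1..l. q ^ k)"
          unfolding mult.assoc[symmetric] M by simp
        also have "real N powr (1/p) / real N = real N powr (- 1 / p')"
        proof -
          have "- 1 / p' = 1 / p - 1" using pp by (simp add: field_simps)
          then show ?thesis using N by (simp add: powr_diff)
        qed
        also have "\<rho> * \<delta> * real N powr (- 1 / p') * (\<Sum>k=1..l. q ^ k) \<le> \<rho> * \<delta> * real N powr (- 1 / p') * (1 / (1 - q))"
          using geo \<rho> \<delta>0 by (intro mult_left_mono) auto
        finally show ?thesis .
      qed
      have e3: "real (card E) * (\<delta> / real M) \<le> \<delta> * real N powr (- 1 / p')"
        using mult_left_mono[OF EM \<delta>0] by (simp add: mult.commute)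
      have "norm (x - (1 / real N) *\<^sub>R sum_list xs) \<le> \<delta> * real N powr (- 1 / p') + \<rho> * \<delta> * real N powr (- 1 / p') * (1 / (1 - q))"
        using e1 e2 e3 norm_triangle_ineq[of "x - (1 / real M) *\<^sub>R (\<Sum>i\<in>I. fst i)" "(1 / real M) *\<^sub>R (\<Sum>i\<in>I. fst i) - (1 / real N) *\<^sub>R sum_list xs"] by simp
      then show ?thesis using xsT by (auto simp: C_def algebra_simps)
    qed
    show "ball_cover (convex hull E) (card E ^ N) (C * \<delta> * real N powr (- 1 / p'))"
      unfolding ball_cover_def
    proof (intro exI[of _ "(\<lambda>xs. (1 / real N) *\<^sub>R sum_list xs) ` T"] conjI)
      have "finite T" "card T = card E ^ N"
        unfolding T_def using E card_lists_length_eq finite_lists_length_eq by auto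
      then show "finite ((\<lambda>xs. (1 / real N) *\<^sub>R sum_list xs) ` T)"
        "card ((\<lambda>xs. (1 / real N) *\<^sub>R sum_list xs) ` T) \<le> card E ^ N" 
        using card_image_le[of T "\<lambda>xs. (1 / real N) *\<^sub>R sum_list xs"] by auto
      show "convex hull E \<subseteq> (\<Union>x\<in>(\<lambda>xs. (1 / real N) *\<^sub>R sum_list xs) ` T. cball x (C * \<delta> * real N powr (- 1 / p')))"
        using near by (fastforce simp: dist_norm norm_minus_commute)
    qed
  qed
qed

section \<open>Entropy numbers of an absolutely convex hull\<close>

text \<open>
  One level of the chain. The real parameter \<open>y\<close> is the desired length of the averages in Maurey's
  lemma. For \<open>y < 1\<close> the claimed radius exceeds \<open>\<delta>\<close> and a single ball around the origin suffices, so
  the estimate is uniform over all levels.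
\<close>

lemma level_cover:
  fixes D :: "'a::real_normed_vector set" and C \<delta> y p' :: real
  assumes maurey: "\<And>(E :: 'a set) \<delta> N. finite E \<Longrightarrow> 0 \<in> E \<Longrightarrow> (\<And>v. v \<in> E \<Longrightarrow> norm v \<le> \<delta>) \<Longrightarrow> 1 \<le> N \<Longrightarrow>
     ball_cover (convex hull E) (card E ^ N) (C * \<delta> * real N powr (- 1 / p'))"
    and C: "1 \<le> C" and p': "1 \<le> p'"
    and D: "finite D" "\<And>v. v \<in> D \<Longrightarrow> norm v \<le> \<delta>" "card D \<le> 2 ^ (2 ^ Suc k - 1)" and "0 \<le> \<delta>" "0 < y"
  shows "ball_cover (aco D) (2 ^ (2 ^ (k + 2) * nat \<lfloor>y\<rfloor>)) (2 * C * \<delta> * y powr (- 1 / p'))"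
proof (cases "y < 1")
  case True
  then have y0: "nat \<lfloor>y\<rfloor> = 0" using \<open>0 < y\<close> by (simp add: floor_eq_iff nat_eq_iff2)
  have "1 \<le> y powr (- 1 / p')"
    using True \<open>0 < y\<close> p' powr_mono'[of "- 1 / p'" 0 y] by simp
  then have "1 * \<delta> \<le> (2 * C * y powr (- 1 / p')) * \<delta>"
    using C \<open>0 \<le> \<delta>\<close> mult_mono[of 1 "2 * C" 1 "y powr (- 1 / p')"] by (intro mult_right_mono) auto
  then have le: "\<delta> \<le> 2 * C * \<delta> * y powr (- 1 / p')" by (simp add: mult_ac)
  have "aco D \<subseteq> cball 0 \<delta>"
    using D(2) by (intro aco_minimal absolutely_convex_cball) auto
  then have "ball_cover (aco D) 1 \<delta>" unfolding ball_cover_def by (intro exI[of _ "{0}"]) auto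
  then show ?thesis using y0 le by (auto elim: ball_cover_mono)
next
  case False
  define N where "N = nat \<lfloor>y\<rfloor>"
  have "1 \<le> \<lfloor>y\<rfloor>" using False by simp
  moreover from this have "real N = of_int \<lfloor>y\<rfloor>" by (simp add: N_def of_nat_nat)
  moreover have "y < of_int \<lfloor>y\<rfloor> + 1" by linarith
  ultimately have N: "1 \<le> N" "y \<le> 2 * real N" by linarith+
  define E where "E = symmetrized D"
  have "card E \<le> 2 * 2 ^ (2 ^ Suc k - 1) + 1"
    using card_symmetrized[OF D(1)] D(3) unfolding E_def by linarith
  also have "\<dots> = 2 ^ (2 ^ Suc k) + 1"
    by (metis Suc_diff_1 power_Suc zero_less_numeral zero_less_power)
  also have "\<dots> \<le> 2 ^ (2 ^ Suc k) * 2" by simp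
  also have "\<dots> = 2 ^ (2 ^ Suc k + 1)" by simp
  also have "\<dots> \<le> 2 ^ (2 ^ (k + 2))" by (intro power_increasing) auto
  finally have "card E ^ N \<le> (2 ^ (2 ^ (k + 2))) ^ N" by (rule power_mono) simp
  then have card: "card E ^ N \<le> 2 ^ (2 ^ (k + 2) * nat \<lfloor>y\<rfloor>)" by (simp add: N_def power_mult)
  have "real N powr (- 1 / p') \<le> (y / 2) powr (- 1 / p')"
    using N \<open>0 < y\<close> p' by (intro powr_mono2') auto
  also have "\<dots> = 2 powr (1 / p') * y powr (- 1 / p')"
    using \<open>0 < y\<close> by (simp add: powr_divide powr_minus_divide)
  also have "\<dots> \<le> 2 * y powr (- 1 / p')"
    using powr_mono[of "1/p'" 1 2] p' by (intro mult_right_mono) auto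
  finally have le: "C * \<delta> * real N powr (- 1 / p') \<le> 2 * C * \<delta> * y powr (- 1 / p')"
    using C \<open>0 \<le> \<delta>\<close> mult_left_mono[of "real N powr (- 1 / p')" "2 * y powr (- 1 / p')" "C * \<delta>"] by (simp add: mult_ac)
  have "ball_cover (convex hull E) (card E ^ N) (C * \<delta> * real N powr (- 1 / p'))"
    using D \<open>0 \<le> \<delta>\<close> N finite_symmetrized[OF D(1)]
    by (intro maurey) (auto simp: E_def symmetrized_def)
  then show ?thesis
    by (rule ball_cover_mono) (use card le aco_subset_hull_symmetrized E_def in auto)
qed

lemma chain_cover:
  fixes N :: "nat \<Rightarrow> 'a::real_normed_vector set" and C p' :: real
  assumes maurey: "\<And>(E :: 'a set) \<delta> N. finite E \<Longrightarrow> 0 \<in> E \<Longrightarrow> (\<And>v. v \<in> E \<Longrightarrow> norm v \<le> \<delta>) \<Longrightarrow> 1 \<le> N \<Longrightarrow>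
     ball_cover (convex hull E) (card E ^ N) (C * \<delta> * real N powr (- 1 / p'))"
    and C: "1 \<le> C" and p': "1 \<le> p'"
    and N: "\<And>k. finite (N k)" "\<And>k. card (N k) \<le> 2 ^ (2 ^ k - 1)"
    and near: "\<And>k y. y \<in> N (Suc k) \<Longrightarrow> \<exists>z\<in>N k. dist y z \<le> d k"
    and d: "\<And>k. 0 \<le> d k" and y: "\<And>k. 0 < y k"
    and base: "ball_cover (aco (N i)) c0 \<rho>0" and "i \<le> j"
  shows "ball_cover (aco (N j)) (c0 * 2 ^ (\<Sum>k=i..<j. 2 ^ (k + 2) * nat \<lfloor>y k\<rfloor>))
           (\<rho>0 + (\<Sum>k=i..<j. 2 * C * d k * y k powr (- 1 / p')))"
  using \<open>i \<le> j\<close>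
proof (induction j rule: dec_induct)
  case base
  show ?case using \<open>ball_cover (aco (N i)) c0 \<rho>0\<close> by simp
next
  case (step j)
  obtain z where z: "\<And>y. y \<in> N (Suc j) \<Longrightarrow> z y \<in> N j" "\<And>y. y \<in> N (Suc j) \<Longrightarrow> dist y (z y) \<le> d j"
    using near[of _ j] by metis
  define D where "D = (\<lambda>y. y - z y) ` N (Suc j)"
  have D: "finite D" "card D \<le> 2 ^ (2 ^ Suc j - 1)" "\<And>v. v \<in> D \<Longrightarrow> norm v \<le> d j"
    using N(1) order_trans[OF card_image_le[OF N(1)] N(2)[of "Suc j"]] z(2) by (auto simp: D_def dist_norm simp del: power_Suc)
  have "N (Suc j) \<subseteq> aco (N j) + aco D"
  proof
    fix x assume x: "x \<in> N (Suc j)"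
    have "z x + (x - z x) \<in> aco (N j) + aco D"
      using x z(1) subset_aco by (intro set_plus_intro) (auto simp: D_def intro: subsetD[OF subset_aco])
    then show "x \<in> aco (N j) + aco D" by simp
  qed
  then have sub: "aco (N (Suc j)) \<subseteq> aco (N j) + aco D"
    by (intro aco_minimal absolutely_convex_set_plus absolutely_convex_aco)
  have "ball_cover (aco D) (2 ^ (2 ^ (j + 2) * nat \<lfloor>y j\<rfloor>)) (2 * C * d j * y j powr (- 1 / p'))"
    using D d y by (intro level_cover[OF maurey C p']) auto
  from ball_cover_set_plus[OF step.IH this] show ?case
    by (rule ball_cover_mono) (use sub step in \<open>auto simp: power_add mult_ac\<close>)
qed

lemma two_power_minus_two: "2 \<le> j \<Longrightarrow> (2::nat) ^ j = 4 * 2 ^ (j - 2)"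
  using le_Suc_ex[of 2 j] by auto

text \<open>
  The first level of the chain: for \<open>2 ^ (i + 1) \<le> j\<close> the net has at most \<open>2 ^ (j div 2)\<close> points,
  so a grid of mesh \<open>2 ^ (-2 j)\<close> needs at most \<open>2 ^ (2 ^ (j - 2))\<close> centres and still has radius
  \<open>R 2 ^ (-j)\<close>, which is negligible against \<open>2 ^ (-j / p')\<close>.
\<close>

lemma coarse_level_cover:
  fixes N :: "'a::real_normed_vector set"
  assumes N: "finite N" "card N \<le> 2 ^ (2 ^ i - 1)" "\<And>v. v \<in> N \<Longrightarrow> norm v \<le> R" and "0 \<le> R"
    and ij: "2 ^ Suc i \<le> j" and "18 \<le> j"
  shows "ball_cover (aco N) (2 ^ (2 ^ (j - 2))) (R * 2 powr (- real j))"
proof -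
  define E where "E = symmetrized N"
  define h where "h = j div 2"
  have h: "2 ^ i \<le> h" "2 * h \<le> j" "j \<le> 2 * h + 1" "9 \<le> h" using ij \<open>18 \<le> j\<close> by (auto simp: h_def)
  have "card E \<le> 2 * 2 ^ (2 ^ i - 1) + 1"
    using card_symmetrized[OF N(1)] N(2) unfolding E_def by linarith
  also have "\<dots> = 2 ^ (2 ^ i) + 1"
    by (metis Suc_diff_1 power_Suc zero_less_numeral zero_less_power)
  also have "\<dots> \<le> 2 ^ (2 ^ i) * 2" by simp
  also have "\<dots> = 2 ^ Suc (2 ^ i)" by simp
  also have "\<dots> \<le> 2 ^ Suc h" using h by (intro power_increasing) auto
  finally have cE: "card E \<le> 2 ^ Suc h" .
  \<comment> \<open>This first holds at \<open>h = 9\<close>, hence the threshold \<open>18\<close> for \<open>j\<close>.\<close>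
  have big: "8 * (4 * h + 3) \<le> 2 ^ h"
    using \<open>9 \<le> h\<close> by (induction h rule: dec_induct) auto
  have "(2 ^ (2 * j) + 1) ^ card E \<le> ((2::nat) ^ (2 * j + 1)) ^ (2 ^ Suc h)"
  proof -
    have "((2::nat) ^ (2 * j) + 1) ^ card E \<le> (2 ^ (2 * j + 1)) ^ card E" by (rule power_mono) auto
    also have "\<dots> \<le> (2 ^ (2 * j + 1)) ^ (2 ^ Suc h)" using cE by (intro power_increasing) auto
    finally show ?thesis .
  qed
  also have "\<dots> = 2 ^ ((2 * j + 1) * 2 ^ Suc h)" by (simp only: power_mult)
  also have "\<dots> \<le> 2 ^ (2 ^ (j - 2))"
  proof (rule power_increasing)
    have "4 * ((2 * j + 1) * 2 ^ Suc h) = 8 * (2 * j + 1) * 2 ^ h" by (simp add: algebra_simps)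
    also have "\<dots> \<le> 8 * (4 * h + 3) * 2 ^ h" using h(3) by (intro mult_right_mono) auto
    also have "\<dots> \<le> 2 ^ h * 2 ^ h" using big by (rule mult_right_mono) simp
    also have "\<dots> = 2 ^ (2 * h)" by (simp add: power_add[symmetric] mult_2)
    also have "\<dots> \<le> 2 ^ j" using h by (intro power_increasing) auto
    also have "\<dots> = 4 * 2 ^ (j - 2)" using \<open>18 \<le> j\<close> by (intro two_power_minus_two) simp
    finally show "(2 * j + 1) * 2 ^ Suc h \<le> 2 ^ (j - 2)" by simp
  qed simp
  finally have count: "(2 ^ (2 * j) + 1) ^ card E \<le> (2::nat) ^ (2 ^ (j - 2))" .
  have "real (card E) \<le> 2 ^ j"
  proof -
    have "card E \<le> 2 ^ j" using order_trans[OF cE, of "2 ^ j"] h power_increasing[of "Suc h" j "2::nat"] by auto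
    then show ?thesis by (metis of_nat_le_iff of_nat_numeral of_nat_power)
  qed
  then have "real (card E) * R / real (2 ^ (2 * j)) \<le> 2 ^ j * R / 2 ^ (2 * j)"
    using \<open>0 \<le> R\<close> by (auto intro!: divide_right_mono mult_right_mono)
  also have "\<dots> = R * 2 powr (- real j)"
    by (simp add: powr_minus powr_realpow power_mult power2_eq_square power_mult_distrib field_simps mult_2 power_add)
  finally have rad: "real (card E) * R / real (2 ^ (2 * j)) \<le> R * 2 powr (- real j)" .
  have "ball_cover (convex hull E) ((2 ^ (2 * j) + 1) ^ card E) (real (card E) * R / real (2 ^ (2 * j)))"
    using N \<open>0 \<le> R\<close> finite_symmetrized by (intro grid_cover) (auto simp: E_def symmetrized_def)
  then show ?thesis
    by (rule ball_cover_mono) (use count rad aco_subset_hull_symmetrized E_def in auto)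
qed

text \<open>
  The lengths allotted to the levels are chosen so that the exponents in the number of
  balls sum to at most half of the available \<open>2 ^ j\<close>.
\<close>

lemma geometric_budget:
  fixes \<eta> :: real
  assumes \<eta>: "0 < \<eta>" and "i \<le> j"
  defines "c \<equiv> (1 - 2 powr - \<eta>) / 8"
  shows "(\<Sum>k=i..<j. 2 ^ (k + 2) * nat \<lfloor>c * 2 powr (real j - real k) * 2 powr (- \<eta> * real (k - i))\<rfloor>) \<le> 2 ^ j div 2"
proof -
  define q where "q = 2 powr - \<eta>"
  have q: "0 < q" "q < 1" using \<eta> by (auto simp: q_def powr_less_one)
  have c: "c = (1 - q) / 8" by (simp add: c_def q_def)
  have "real (\<Sum>k=i..<j. 2 ^ (k + 2) * nat \<lfloor>c * 2 powr (real j - real k) * 2 powr (- \<eta> * real (k - i))\<rfloor>)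
      = (\<Sum>k=i..<j. 2 ^ (k + 2) * real (nat \<lfloor>c * 2 powr (real j - real k) * 2 powr (- \<eta> * real (k - i))\<rfloor>))"
    by simp
  also have "\<dots> \<le> (\<Sum>k=i..<j. 2 ^ (k + 2) * (c * 2 powr (real j - real k) * 2 powr (- \<eta> * real (k - i))))"
    using q c by (intro sum_mono mult_left_mono) (auto simp: of_nat_nat)
  also have "\<dots> = (\<Sum>k=i..<j. 4 * c * 2 ^ j * q ^ (k - i))"
  proof (rule sum.cong[OF refl])
    fix k
    have "2 powr (- \<eta> * real (k - i)) = q ^ (k - i)" by (simp add: q_def powr_realpow[symmetric] powr_powr)
    moreover have "2 ^ (k + 2) * 2 powr (real j - real k) = 4 * 2 ^ j"
      by (simp add: powr_diff powr_realpow power_add)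
    ultimately show "2 ^ (k + 2) * (c * 2 powr (real j - real k) * 2 powr (- \<eta> * real (k - i))) = 4 * c * 2 ^ j * q ^ (k - i)"
      by (simp add: mult_ac)
  qed
  also have "\<dots> = 4 * c * 2 ^ j * (\<Sum>k=i..<j. q ^ (k - i))" by (simp add: sum_distrib_left)
  also have "\<dots> \<le> 4 * c * 2 ^ j * (1 / (1 - q))"
  proof (rule mult_left_mono)
    have "(\<Sum>k=i..<j. q ^ (k - i)) = (\<Sum>m\<in>(\<lambda>k. k - i) ` {i..<j}. q ^ m)"
      by (subst sum.reindex) (auto intro!: inj_onI)
    also have "\<dots> \<le> (\<Sum>m. q ^ m)" using q by (intro sum_le_suminf summable_geometric) auto
    also have "\<dots> = 1 / (1 - q)" using q by (simp add: suminf_geometric)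
    finally show "(\<Sum>k=i..<j. q ^ (k - i)) \<le> 1 / (1 - q)" .
  qed (use q c in auto)
  also have "\<dots> = 2 ^ j / 2"
  proof -
    have "4 * c * (1 / (1 - q)) = 1 / 2" using q unfolding c by (simp add: field_simps)
    moreover have "4 * c * 2 ^ j * (1 / (1 - q)) = 4 * c * (1 / (1 - q)) * 2 ^ j" by (simp only: mult_ac)
    ultimately show ?thesis by (simp only: mult.commute[of "2 ^ j"] times_divide_eq_left mult_1)
  qed
  finally have half: "real (\<Sum>k=i..<j. 2 ^ (k + 2) * nat \<lfloor>c * 2 powr (real j - real k) * 2 powr (- \<eta> * real (k - i))\<rfloor>) \<le> 2 ^ j / 2" .
  define S where "S = (\<Sum>k=i..<j. 2 ^ (k + 2) * nat \<lfloor>c * 2 powr (real j - real k) * 2 powr (- \<eta> * real (k - i))\<rfloor>)"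
  have "real S \<le> 2 ^ j / 2" using half unfolding S_def .
  then have "real (2 * S) \<le> real (2 ^ j)" by simp
  then have "2 * S \<le> 2 ^ j" by (simp only: of_nat_le_iff)
  then show ?thesis unfolding S_def by linarith
qed

text \<open>
  The nets are pruned to balls that meet \<open>A\<close>, so that points of consecutive nets can be
  compared through a common point of \<open>A\<close>. The last error \<open>\<epsilon> j\<close> has the size of the term \<open>k = j\<close>
  and is absorbed into the sum.
\<close>

lemma aco_entropy_bound:
  fixes A :: "'a::real_normed_vector set" and C p' \<eta> :: real
  assumes maurey: "\<And>(E :: 'a set) \<delta> N. finite E \<Longrightarrow> 0 \<in> E \<Longrightarrow> (\<And>v. v \<in> E \<Longrightarrow> norm v \<le> \<delta>) \<Longrightarrow> 1 \<le> N \<Longrightarrow>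
     ball_cover (convex hull E) (card E ^ N) (C * \<delta> * real N powr (- 1 / p'))"
    and C: "1 \<le> C" and p': "1 \<le> p'" and \<eta>: "0 < \<eta>"
    and A: "A \<noteq> {}" "A \<subseteq> cball 0 R0"
    and eps: "\<And>k. 0 < \<epsilon> k" "antimono \<epsilon>" "\<And>k. ball_cover A (2 ^ (2 ^ k - 1)) (\<epsilon> k)"
    and ij: "2 ^ Suc i \<le> j" "18 \<le> j"
  shows "dyadic_entropy_number UNIV dist (aco A) (2 ^ j) \<le> (R0 + \<epsilon> 0) * 2 powr (- real j)
     + 4 * C * ((1 - 2 powr - \<eta>) / 8) powr (- 1 / p')
        * (\<Sum>k=i..j. \<epsilon> k * 2 powr (- (real j - real k) / p') * 2 powr (\<eta> * real (k - i) / p'))"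
proof -
  define c where "c = (1 - 2 powr - \<eta>) / 8"
  have q: "2 powr - \<eta> < 1" using \<eta> by (simp add: powr_less_one)
  have c: "0 < c" "c \<le> 1" using q powr_ge_zero[of 2 "- \<eta>"] by (auto simp: c_def simp del: powr_ge_zero)
  define y where "y k = c * 2 powr (real j - real k) * 2 powr (- \<eta> * real (k - i))" for k
  have "\<forall>k. \<exists>F. finite F \<and> card F \<le> 2 ^ (2 ^ k - 1) \<and> A \<subseteq> (\<Union>x\<in>F. cball x (\<epsilon> k))"
    using eps(3) unfolding ball_cover_def by blast
  then obtain F where F: "\<And>k. finite (F k)" "\<And>k. card (F k) \<le> 2 ^ (2 ^ k - 1)" "\<And>k. A \<subseteq> (\<Union>x\<in>F k. cball x (\<epsilon> k))"
    by metis
  define N where "N k = {x \<in> F k. \<exists>a\<in>A. dist x a \<le> \<epsilon> k}" for k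
  have N: "finite (N k)" "card (N k) \<le> 2 ^ (2 ^ k - 1)" for k
    using F(1,2)[of k] card_mono[of "F k" "N k"] by (auto simp: N_def)
  have net: "\<exists>x\<in>N k. dist x a \<le> \<epsilon> k" if "a \<in> A" for a k
  proof -
    obtain x where "x \<in> F k" "dist x a \<le> \<epsilon> k" using F(3)[of k] \<open>a \<in> A\<close> by fastforce
    then show ?thesis using that by (auto simp: N_def)
  qed
  have anti: "\<epsilon> l \<le> \<epsilon> k" if "k \<le> l" for k l using antimonoD[OF eps(2) that] .
  have near: "\<exists>z\<in>N k. dist x z \<le> 2 * \<epsilon> k" if x: "x \<in> N (Suc k)" for x k
  proof -
    obtain a where a: "a \<in> A" "dist x a \<le> \<epsilon> (Suc k)" using x by (auto simp: N_def)
    obtain z where z: "z \<in> N k" "dist z a \<le> \<epsilon> k" using net[OF a(1)] by blast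
    have "dist x z \<le> 2 * \<epsilon> k"
      using dist_triangle2[of x z a] a(2) z(2) anti[of k "Suc k"] by linarith
    then show ?thesis using z(1) by blast
  qed
  define R where "R = R0 + \<epsilon> 0"
  have NR: "norm x \<le> R" if x: "x \<in> N k" for x k
  proof -
    obtain a where a: "a \<in> A" "dist x a \<le> \<epsilon> k" using x by (auto simp: N_def)
    then have "norm a \<le> R0" using A(2) by auto
    then show ?thesis using a(2) anti[of 0 k] norm_triangle_sub[of x a] by (simp add: R_def dist_norm)
  qed
  have "0 \<le> R" using A eps(1)[of 0] norm_ge_zero order_trans unfolding R_def by (fastforce simp: subset_eq)
  have "i \<le> 2 ^ Suc i" using less_exp[of "Suc i"] by simp
  then have "i \<le> j" using ij(1) by linarith
  have "ball_cover (aco (N j)) (2 ^ (2 ^ (j - 2)) * 2 ^ (\<Sum>k=i..<j. 2 ^ (k + 2) * nat \<lfloor>y k\<rfloor>))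
           (R * 2 powr (- real j) + (\<Sum>k=i..<j. 2 * C * (2 * \<epsilon> k) * y k powr (- 1 / p')))"
  proof (rule chain_cover[OF maurey C p' N near _ _ _ \<open>i \<le> j\<close>])
    show "ball_cover (aco (N i)) (2 ^ 2 ^ (j - 2)) (R * 2 powr - real j)"
      using NR \<open>0 \<le> R\<close> by (intro coarse_level_cover[OF N _ _ ij])
    show "0 \<le> 2 * \<epsilon> k" "0 < y k" for k using eps(1)[of k] c by (auto simp: y_def)
  qed
  moreover have "ball_cover (cball (0::'a) (\<epsilon> j)) 1 (\<epsilon> j)" unfolding ball_cover_def by (intro exI[of _ "{0}"]) auto
  ultimately have cov: "ball_cover (aco (N j) + cball 0 (\<epsilon> j)) (2 ^ (2 ^ (j - 2)) * 2 ^ (\<Sum>k=i..<j. 2 ^ (k + 2) * nat \<lfloor>y k\<rfloor>) * 1)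
           (R * 2 powr (- real j) + (\<Sum>k=i..<j. 2 * C * (2 * \<epsilon> k) * y k powr (- 1 / p')) + \<epsilon> j)"
    by (rule ball_cover_set_plus)
  have "A \<subseteq> aco (N j) + cball 0 (\<epsilon> j)"
  proof
    fix a assume "a \<in> A"
    then obtain x where x: "x \<in> N j" "dist x a \<le> \<epsilon> j" using net by blast
    then have "x + (a - x) \<in> aco (N j) + cball 0 (\<epsilon> j)"
      by (intro set_plus_intro) (auto simp: dist_norm norm_minus_commute intro: subsetD[OF subset_aco])
    then show "a \<in> aco (N j) + cball 0 (\<epsilon> j)" by simp
  qed
  then have sub: "aco A \<subseteq> aco (N j) + cball 0 (\<epsilon> j)"
    by (intro aco_minimal absolutely_convex_set_plus absolutely_convex_aco absolutely_convex_cball)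
  have "2 ^ (j - 2) + (\<Sum>k=i..<j. 2 ^ (k + 2) * nat \<lfloor>y k\<rfloor>) \<le> (2::nat) ^ j - 1"
  proof -
    have "(2::nat) ^ j = 4 * 2 ^ (j - 2)" using ij(2) by (intro two_power_minus_two) simp
    moreover have "(1::nat) \<le> 2 ^ (j - 2)" by simp
    moreover have "(\<Sum>k=i..<j. 2 ^ (k + 2) * nat \<lfloor>y k\<rfloor>) \<le> 2 ^ j div 2"
      unfolding y_def c_def by (rule geometric_budget[OF \<eta> \<open>i \<le> j\<close>])
    ultimately show ?thesis by linarith
  qed
  then have "(2::nat) ^ (2 ^ (j - 2)) * 2 ^ (\<Sum>k=i..<j. 2 ^ (k + 2) * nat \<lfloor>y k\<rfloor>) * 1 \<le> 2 ^ (2 ^ j - 1)"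
    unfolding mult_1_right power_add[symmetric] by (rule power_increasing) simp
  then obtain G where G: "finite G" "card G \<le> 2 ^ (2 ^ j - 1)"
    "aco A \<subseteq> (\<Union>x\<in>G. cball x (R * 2 powr (- real j) + (\<Sum>k=i..<j. 2 * C * (2 * \<epsilon> k) * y k powr (- 1 / p')) + \<epsilon> j))"
    using ball_cover_mono[OF cov sub _ order_refl] unfolding ball_cover_def by blast
  have "G \<noteq> {}" using G(3) A(1) subset_aco[of A] by auto
  have yp: "2 * C * (2 * \<epsilon> k) * y k powr (- 1 / p') =
     4 * C * c powr (- 1 / p') * (\<epsilon> k * 2 powr (- (real j - real k) / p') * 2 powr (\<eta> * real (k - i) / p'))" for k
    using c by (simp add: y_def powr_mult powr_powr diff_divide_distrib)
  have "1 \<le> c powr (- 1 / p')" using c p' powr_mono'[of "- 1 / p'" 0 c] by simp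
  then have "1 * 1 \<le> (4 * C) * c powr (- 1 / p')" using C by (intro mult_mono) auto
  moreover have "1 \<le> 2 powr (\<eta> * real (j - i) / p')" using \<eta> p' by (intro ge_one_powr_ge_zero) auto
  ultimately have "1 * 1 \<le> 4 * C * c powr (- 1 / p') * 2 powr (\<eta> * real (j - i) / p')"
    by (intro mult_mono) auto
  from mult_right_mono[OF this less_imp_le[OF eps(1)[of j]]]
  have ej: "\<epsilon> j \<le> 4 * C * c powr (- 1 / p') * (\<epsilon> j * 2 powr (- (real j - real j) / p') * 2 powr (\<eta> * real (j - i) / p'))"
    by (simp add: mult_ac)
  have "(\<Sum>k=i..<j. 2 * C * (2 * \<epsilon> k) * y k powr (- 1 / p')) + \<epsilon> j \<le>
     4 * C * c powr (- 1 / p') * (\<Sum>k=i..j. \<epsilon> k * 2 powr (- (real j - real k) / p') * 2 powr (\<eta> * real (k - i) / p'))"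
  proof -
    have "{i..j} = insert j {i..<j}" using \<open>i \<le> j\<close> by auto
    then show ?thesis unfolding yp sum_distrib_left[symmetric] using ej by (simp add: distrib_left)
  qed
  moreover have "dyadic_entropy_number UNIV dist (aco A) (2 ^ j) \<le>
     R * 2 powr (- real j) + (\<Sum>k=i..<j. 2 * C * (2 * \<epsilon> k) * y k powr (- 1 / p')) + \<epsilon> j"
    unfolding dyadic_entropy_number_def
  proof (rule Met_TC.entropy_number_le[OF _ G(1) \<open>G \<noteq> {}\<close> G(2)])
    show "0 \<le> R * 2 powr (- real j) + (\<Sum>k=i..<j. 2 * C * (2 * \<epsilon> k) * y k powr (- 1 / p')) + \<epsilon> j"
      using \<open>0 \<le> R\<close> eps(1) C by (intro add_nonneg_nonneg sum_nonneg mult_nonneg_nonneg) (auto intro: less_imp_le)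
  qed (use G(3) in auto)
  ultimately show ?thesis unfolding R_def c_def by linarith
qed

text \<open>
  The constant \<open>\<eta>\<close> is chosen so that the growth \<open>2 powr (\<eta> (k - i) / p')\<close> of the radii uses up half of the
  decay \<open>2 powr (- \<kappa> (k - i))\<close>, \<open>\<kappa> = 1 / r - 1 / p'\<close>, that the hypothesis offers. After this all
  \<open>j\<close> in the block \<open>{2 ^ (i + 1)..<2 ^ (i + 2)}\<close> obey one bound proportional to \<open>V i / 2 ^ i\<close>, up to a summable error.
\<close>

theorem aco_dyadic_entropy_lorentz:
  fixes A :: "'a::real_normed_vector set" and p p' r s \<alpha> :: real
  assumes type: "of_type TYPE('a) p" and p: "1 < p" and pp: "1 / p + 1 / p' = 1"
    and r: "0 < r" "r < p'" and s: "0 < s" and \<alpha>: "\<alpha> = 1 / s + 1 / p' - 1 / r"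
    and A: "bounded A" and eA: "dyadic_entropy_number UNIV dist A \<in> lorentz r s 0"
  shows "dyadic_entropy_number UNIV dist (aco A) \<in> lorentz p' s \<alpha>"
proof -
  obtain R0 where "0 < R0" and AR: "A \<subseteq> cball 0 R0" using bounded_subset_ballD[OF A, of 0] ball_subset_cball by blast
  have aR: "aco A \<subseteq> cball 0 R0" by (rule aco_minimal[OF AR absolutely_convex_cball])
  define \<xi> where "\<xi> = dyadic_entropy_number UNIV dist A"
  define \<zeta> where "\<zeta> = dyadic_entropy_number UNIV dist (aco A)"
  have AR': "A \<subseteq> Met_TC.mcball 0 R0" and aR': "aco A \<subseteq> Met_TC.mcball 0 R0" using AR aR by auto
  have \<xi>: "0 \<le> \<xi> n" "antimono_on {1..} \<xi>" for n
    unfolding \<xi>_def by (rule Met_TC.dyadic_entropy_nonneg[OF _ AR'] Met_TC.dyadic_entropy_antimono[OF _ AR'], simp)+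
  have \<zeta>: "0 \<le> \<zeta> n" "antimono_on {1..} \<zeta>" for n
    unfolding \<zeta>_def by (rule Met_TC.dyadic_entropy_nonneg[OF _ aR'] Met_TC.dyadic_entropy_antimono[OF _ aR'], simp)+
  have ip: "1 / p' = 1 - 1 / p" using pp by simp
  have "0 < 1 / p'" "1 / p' < 1" using p unfolding ip by (auto simp: field_simps)
  then have p': "0 < p'" "1 \<le> p'" by (auto simp: field_simps)
  have s_xi: "summable (lorentz_term r s 0 \<xi>)"
    using eA lorentz_iff_dyadic[OF r(1) s] \<xi> unfolding \<xi>_def[symmetric] by auto
  define t where "t = lorentz_term p' s \<alpha> \<zeta>"
  have t0: "0 \<le> t j" for j by (simp add: t_def lorentz_term_def)
  have "summable t"
  proof (cases "A = {}")
    case True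
    have "aco A \<subseteq> {}" unfolding True by (rule aco_minimal) (auto simp: absolutely_convex_def)
    then have "\<zeta> n \<le> 0" for n unfolding \<zeta>_def dyadic_entropy_number_def
      by (intro Met_TC.entropy_number_le[of _ "{0}"]) auto
    then have "\<zeta> n = 0" for n using \<zeta>(1)[of n] by (simp add: order.antisym)
    then show ?thesis using s by (simp add: t_def lorentz_term_def[abs_def])
  next
    case False
    obtain C where C: "1 \<le> C" and maurey: "\<And>(E :: 'a set) \<delta> N. finite E \<Longrightarrow> 0 \<in> E \<Longrightarrow>
      (\<And>v. v \<in> E \<Longrightarrow> norm v \<le> \<delta>) \<Longrightarrow> 1 \<le> N \<Longrightarrow>
      ball_cover (convex hull E) (card E ^ N) (C * \<delta> * real N powr (- 1 / p'))"
      using maurey_cover[OF type p pp] by blast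
    define \<kappa> where "\<kappa> = 1 / r - 1 / p'"
    have \<kappa>: "0 < \<kappa>" using r by (simp add: \<kappa>_def field_simps)
    define \<mu> where "\<mu> = \<kappa> / 2"
    define \<eta> where "\<eta> = \<mu> * p'"
    have \<mu>: "0 < \<mu>" and \<eta>: "0 < \<eta>" using \<kappa> p' by (auto simp: \<mu>_def \<eta>_def)
    \<comment> \<open>The added term makes \<open>\<epsilon> k\<close> larger than an entropy number, which need not be attained as
       a covering radius; it decays fast enough not to affect summability.\<close>
    define \<epsilon> where "\<epsilon> k = \<xi> (2 ^ k) + 2 powr (- (1 / r + 1) * real k)" for k
    have eps0: "0 < \<epsilon> k" for k using \<xi>(1)[of "2^k"] by (simp add: \<epsilon>_def add_nonneg_pos)
    have eps_anti: "antimono \<epsilon>"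
    proof (rule antimonoI)
      fix k l :: nat assume "k \<le> l"
      then have "\<xi> (2 ^ l) \<le> \<xi> (2 ^ k)" by (intro monotone_onD[OF \<xi>(2)]) auto
      moreover have "2 powr (- (1 / r + 1) * real l) \<le> 2 powr (- (1 / r + 1) * real k)"
      proof -
        have "0 < 1 / r" using r by simp
        then have "- (1 / r + 1) \<le> 0" by linarith
        then have "- (1 / r + 1) * real l \<le> - (1 / r + 1) * real k"
          using \<open>k \<le> l\<close> by (intro mult_left_mono_neg of_nat_mono)
        then show ?thesis by (intro powr_mono) auto
      qed
      ultimately show "\<epsilon> l \<le> \<epsilon> k" by (simp only: \<epsilon>_def add_mono)
    qed
    have eps_cover: "ball_cover A (2 ^ (2 ^ k - 1)) (\<epsilon> k)" for k
    proof -
      have "entropy_number UNIV dist (2 ^ (2 ^ k - 1)) A < \<epsilon> k"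
        unfolding \<epsilon>_def \<xi>_def dyadic_entropy_number_def by simp
      then obtain F where "finite F" "card F \<le> 2 ^ (2 ^ k - 1)" "A \<subseteq> (\<Union>x\<in>F. Met_TC.mcball x (\<epsilon> k))"
        using Met_TC.entropy_number_less_imp_cover[OF UNIV_I AR' one_le_power, of 2 "2 ^ k - 1" "\<epsilon> k"] by auto
      then show ?thesis unfolding ball_cover_def mcball_eq_cball by blast
    qed
    define b where "b k = \<epsilon> k * 2 powr (real k / r)" for k
    have b0: "0 \<le> b k" for k using eps0[of k] by (simp add: b_def)
    have "summable (\<lambda>k. b k powr s)"
    proof (rule summable_comparison_test'[where N = 0])
      show "summable (\<lambda>k. 2 powr s * (lorentz_term r s 0 \<xi> k + (2 powr (- s)) ^ k))"
        using s by (intro summable_mult summable_add s_xi summable_geometric) (simp add: powr_less_one)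
      fix k
      have "b k = \<xi> (2 ^ k) * 2 powr (real k / r) + 2 powr (- real k)"
        by (simp add: b_def \<epsilon>_def distrib_right powr_add[symmetric] algebra_simps)
      then have "b k powr s \<le> 2 powr s * ((\<xi> (2 ^ k) * 2 powr (real k / r)) powr s + (2 powr (- real k)) powr s)"
        using s \<xi>(1) by (auto intro!: powr_add_le)
      also have "(\<xi> (2 ^ k) * 2 powr (real k / r)) powr s = lorentz_term r s 0 \<xi> k"
        using \<xi>(1) by (simp add: lorentz_term_def powr_mult powr_powr mult_ac)
      also have "(2 powr (- real k)) powr s = (2 powr (- s)) ^ k"
        by (simp add: powr_realpow[symmetric] powr_powr mult_ac)
      finally show "norm (b k powr s) \<le> 2 powr s * (lorentz_term r s 0 \<xi> k + (2 powr (- s)) ^ k)" by simp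
    qed
    from geometric_average_powr_summable[OF b0 s \<mu> this]
    obtain V G where V: "summable V" "\<And>i. 0 \<le> V i" and G: "0 < G"
      and hardy: "\<And>i j. (\<Sum>k=i..j. b k * 2 powr (- \<mu> * real (k - i))) powr s \<le> G * V i" by metis
    define K where "K = 4 * C * ((1 - 2 powr - \<eta>) / 8) powr (- 1 / p')"
    have K: "0 \<le> K" using C by (simp add: K_def)
    define R where "R = R0 + \<epsilon> 0"
    have R: "0 \<le> R" using \<open>0 < R0\<close> eps0[of 0] by (simp add: R_def)
    define g where "g j = real (j + 1) powr (- \<alpha> * s) * 2 powr (- (s / p) * real j)" for j
    have g: "summable g" unfolding g_def[abs_def] using s p by (intro summable_poly_geometric) auto
    define K1 where "K1 = 2 powr s * R powr s"
    define K2 where "K2 = 2 powr s * K powr s * G * 2 powr (\<bar>- \<alpha> * s\<bar> - \<alpha> * s)"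
    have K2: "0 \<le> K2" using G by (simp add: K2_def)
    have main: "t j \<le> K1 * g j + K2 * (V i / 2 ^ i)" if ij: "2 ^ Suc i \<le> j" "j < 2 ^ Suc (Suc i)" "18 \<le> j" for i j
    proof -
      define T where "T = (\<Sum>k=i..j. b k * 2 powr (- \<mu> * real (k - i)))"
      have T0: "0 \<le> T" using b0 by (auto simp: T_def intro!: sum_nonneg)
      have "\<zeta> (2 ^ j) \<le> R * 2 powr (- real j) + K *
        (\<Sum>k=i..j. \<epsilon> k * 2 powr (- (real j - real k) / p') * 2 powr (\<eta> * real (k - i) / p'))"
        unfolding \<zeta>_def R_def K_def
        by (rule aco_entropy_bound[OF maurey C p'(2) \<eta> False AR eps0 eps_anti eps_cover ij(1,3)])
      also have "(\<Sum>k=i..j. \<epsilon> k * 2 powr (- (real j - real k) / p') * 2 powr (\<eta> * real (k - i) / p')) =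
        2 powr (- real j / p' - real i * \<kappa>) * T"
        unfolding T_def sum_distrib_left
      proof (rule sum.cong[OF refl])
        fix k assume k: "k \<in> {i..j}"
        have "- (real j - real k) / p' + \<eta> * real (k - i) / p' =
           (- real j / p' - real i * \<kappa>) + (real k / r + - \<mu> * real (k - i))"
        proof -
          have "\<eta> * real (k - i) / p' = \<mu> * (real k - real i)" using p' k by (simp add: \<eta>_def of_nat_diff)
          moreover have "\<mu> * (real k - real i) + \<mu> * (real k - real i) = (1 / r - 1 / p') * (real k - real i)"
            by (simp add: \<mu>_def \<kappa>_def)
          ultimately show ?thesis using k by (simp add: of_nat_diff \<kappa>_def algebra_simps diff_divide_distrib)
        qed
        then have "2 powr (- (real j - real k) / p') * 2 powr (\<eta> * real (k - i) / p') =
            2 powr (- real j / p' - real i * \<kappa>) * (2 powr (real k / r) * 2 powr (- \<mu> * real (k - i)))"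
          by (simp only: powr_add[symmetric])
        then show "\<epsilon> k * 2 powr (- (real j - real k) / p') * 2 powr (\<eta> * real (k - i) / p') =
          2 powr (- real j / p' - real i * \<kappa>) * (b k * 2 powr (- \<mu> * real (k - i)))"
          unfolding b_def by (simp only: mult.assoc mult.left_commute)
      qed
      finally have "\<zeta> (2 ^ j) powr s \<le> (R * 2 powr (- real j) + K * (2 powr (- real j / p' - real i * \<kappa>) * T)) powr s"
        using \<zeta>(1) s by (intro powr_mono2) auto
      also have "\<dots> \<le> 2 powr s * ((R * 2 powr (- real j)) powr s + (K * (2 powr (- real j / p' - real i * \<kappa>) * T)) powr s)"
        using R K T0 s by (intro powr_add_le) auto
      also have "\<dots> = 2 powr s * (R powr s * 2 powr (- real j * s) + K powr s * (2 powr ((- real j / p' - real i * \<kappa>) * s) * T powr s))"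
        using R K T0 by (simp add: powr_mult powr_powr)
      also have "\<dots> \<le> 2 powr s * (R powr s * 2 powr (- real j * s) + K powr s * (2 powr ((- real j / p' - real i * \<kappa>) * s) * (G * V i)))"
        using hardy[of i j] unfolding T_def[symmetric] by (intro mult_left_mono add_left_mono) auto
      finally have zs: "\<zeta> (2 ^ j) powr s \<le> \<dots>" .
      define w where "w = real (j + 1) powr (- \<alpha> * s) * 2 powr (real j * s / p')"
      have "t j \<le> w * (2 powr s * (R powr s * 2 powr (- real j * s) + K powr s * (2 powr ((- real j / p' - real i * \<kappa>) * s) * (G * V i))))"
        unfolding t_def lorentz_term_def w_def by (intro mult_left_mono zs) auto
      also have "\<dots> = K1 * (w * 2 powr (- real j * s)) + 2 powr s * K powr s * G * (w * 2 powr ((- real j / p' - real i * \<kappa>) * s)) * V i"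
        by (simp add: K1_def algebra_simps)
      also have "w * 2 powr (- real j * s) = g j"
      proof -
        have "real j * s / p' = real j * s * (1 / p')" by simp
        then have "real j * s / p' + - real j * s = - (s / p) * real j"
          unfolding ip by (simp add: algebra_simps)
        then show ?thesis unfolding w_def g_def mult.assoc powr_add[symmetric] by simp
      qed
      also have "w * 2 powr ((- real j / p' - real i * \<kappa>) * s) = real (j + 1) powr (- \<alpha> * s) * 2 powr (- real i * \<kappa> * s)"
      proof -
        have "real j * s / p' + (- real j / p' - real i * \<kappa>) * s = - real i * \<kappa> * s"
          by (simp add: algebra_simps)
        then show ?thesis unfolding w_def mult.assoc powr_add[symmetric] by simp
      qed
      also have "2 powr s * K powr s * G * (real (j + 1) powr (- \<alpha> * s) * 2 powr (- real i * \<kappa> * s)) * V i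
          \<le> 2 powr s * K powr s * G * (2 powr (\<bar>- \<alpha> * s\<bar> - \<alpha> * s) / 2 ^ i) * V i"
      proof (intro mult_right_mono mult_left_mono V)
        have "j + 1 \<le> 2 * 2 ^ Suc i" using ij(2) by simp
        then have "real (j + 1) \<le> real (2 * 2 ^ Suc i)" "real (2 ^ Suc i) \<le> real j"
          using ij(1) by (simp_all only: of_nat_le_iff)
        then have j1: "real j + 1 \<le> 2 * 2 ^ Suc i" "2 ^ Suc i \<le> real j" by simp_all
        have "real (j + 1) powr (- \<alpha> * s) \<le> 2 powr \<bar>- \<alpha> * s\<bar> * (2 ^ Suc i) powr (- \<alpha> * s)"
          using j1 by (intro powr_comparable) auto
        also have "(2 ^ Suc i) powr (- \<alpha> * s) = 2 powr (real (Suc i) * (- \<alpha> * s))"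
          by (simp only: powr_realpow[symmetric, of 2] powr_powr zero_less_numeral)
        finally have "real (j + 1) powr (- \<alpha> * s) * 2 powr (- real i * \<kappa> * s) \<le>
           2 powr \<bar>- \<alpha> * s\<bar> * 2 powr (real (Suc i) * (- \<alpha> * s)) * 2 powr (- real i * \<kappa> * s)"
          by (rule mult_right_mono) simp
        also have "\<dots> = 2 powr (\<bar>- \<alpha> * s\<bar> - \<alpha> * s) * 2 powr (- real i)"
        proof -
          have as: "- \<alpha> * s = \<kappa> * s - 1" using s unfolding \<alpha> \<kappa>_def by (simp add: algebra_simps)
          have "real (Suc i) * (- \<alpha> * s) + - real i * \<kappa> * s = - \<alpha> * s - real i"
            unfolding as by (simp add: algebra_simps)
          then have "\<bar>- \<alpha> * s\<bar> + real (Suc i) * (- \<alpha> * s) + - real i * \<kappa> * s = \<bar>- \<alpha> * s\<bar> - \<alpha> * s + - real i"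
            by simp
          then show ?thesis by (simp only: powr_add[symmetric])
        qed
        also have "2 powr (- real i) = 1 / 2 ^ i" by (simp add: powr_minus powr_realpow divide_inverse)
        finally show "real (j + 1) powr (- \<alpha> * s) * 2 powr (- real i * \<kappa> * s) \<le> 2 powr (\<bar>- \<alpha> * s\<bar> - \<alpha> * s) / 2 ^ i" by simp
      qed (use G in auto)
      finally show ?thesis by (simp add: K2_def)
    qed
    have g0: "0 \<le> g n" for n by (simp add: g_def)
    have "g summable_on {1..}"
      using g g0 summable_on_subset_banach[of g UNIV "{1..}"] by (simp add: summable_on_UNIV_nonneg_real_iff)
    then have g_blocks: "summable (\<lambda>l. \<Sum>j\<in>{2^l..<2^Suc l}. g j)"
      using summable_on_iff_dyadic_blocks[of g] g0 by simp
    have "summable (\<lambda>l. \<Sum>j\<in>{2^l..<2^Suc l}. t j)"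
    \<comment> \<open>Block \<open>l\<close> corresponds to \<open>i = l - 1\<close>; from \<open>l = 5\<close> on, \<open>j \<ge> 32\<close> lies in the range of
       the entropy estimate.\<close>
    proof (rule summable_comparison_test'[where N = 5])
      have "summable (\<lambda>l. V (l - 1))" using V(1) summable_Suc_iff[of "\<lambda>l. V (l - 1)"] by simp
      then show "summable (\<lambda>l. K1 * (\<Sum>j\<in>{2^l..<2^Suc l}. g j) + K2 * 2 * V (l - 1))"
        by (intro summable_add summable_mult g_blocks)
      fix l :: nat assume l: "5 \<le> l"
      then obtain i where i: "l = Suc i" by (cases l) auto
      have "(2::nat) ^ 5 \<le> 2 ^ l" using l by (intro power_increasing) auto
      then have "t j \<le> K1 * g j + K2 * (V i / 2 ^ i)" if "j \<in> {2^l..<2^Suc l}" for j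
        using that by (intro main) (auto simp: i)
      then have "(\<Sum>j\<in>{2^l..<2^Suc l}. t j) \<le> (\<Sum>j\<in>{2^l..<2^Suc l}. K1 * g j + K2 * (V i / 2 ^ i))"
        by (rule sum_mono)
      also have "\<dots> = K1 * (\<Sum>j\<in>{2^l..<2^Suc l}. g j) + K2 * 2 * V (l - 1)"
        by (simp add: sum.distrib sum_distrib_left i)
      finally show "norm (\<Sum>j\<in>{2^l..<2^Suc l}. t j) \<le> K1 * (\<Sum>j\<in>{2^l..<2^Suc l}. g j) + K2 * 2 * V (l - 1)"
        using t0 by (simp add: sum_nonneg)
    qed
    then have "t summable_on {1..}" using summable_on_iff_dyadic_blocks[of t] t0 by simp
    then have "t summable_on (insert 0 {1..})" by (simp add: summable_on_insert_iff)
    moreover have "insert 0 {1..} = (UNIV :: nat set)" by auto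
    ultimately show ?thesis using summable_on_imp_summable by metis
  qed
  then show ?thesis
    using lorentz_iff_dyadic[OF p'(1) s, of \<zeta> \<alpha>] \<zeta> unfolding t_def \<zeta>_def[symmetric] by auto
qed

section \<open>Optimality in the sequence spaces\<close>

definition spike :: "real \<Rightarrow> nat \<Rightarrow> nat \<Rightarrow> real" where
  "spike c i = (\<lambda>n. if n = i then c else 0)"

lemma spike_lp:
  assumes "0 < p"
  shows "spike c i \<in> lp_space p" "lp_norm p (spike c i) = \<bar>c\<bar>"
proof -
  have eq: "(\<lambda>n. \<bar>spike c i n\<bar> powr p) = (\<lambda>n. if n = i then \<bar>c\<bar> powr p else 0)"
    by (auto simp: spike_def)
  have "(\<lambda>n. \<bar>spike c i n\<bar> powr p) sums (\<bar>c\<bar> powr p)"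
    unfolding eq by (rule sums_single)
  then show "spike c i \<in> lp_space p" "lp_norm p (spike c i) = \<bar>c\<bar>"
    using assms by (auto simp: lp_space_def lp_norm_def sums_iff powr_powr)
qed

lemma lp_scaleR:
  assumes "0 < p" "x \<in> lp_space p"
  shows "c *\<^sub>R x \<in> lp_space p" "lp_norm p (c *\<^sub>R x) = \<bar>c\<bar> * lp_norm p x"
proof -
  have eq: "(\<lambda>n. \<bar>(c *\<^sub>R x) n\<bar> powr p) = (\<lambda>n. \<bar>c\<bar> powr p * \<bar>x n\<bar> powr p)"
    by (auto simp: scaleR_fun_def abs_mult powr_mult)
  have sm: "summable (\<lambda>n. \<bar>x n\<bar> powr p)" using assms(2) by (simp add: lp_space_def)
  then show "c *\<^sub>R x \<in> lp_space p" unfolding lp_space_def by (simp add: eq summable_mult)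
  show "lp_norm p (c *\<^sub>R x) = \<bar>c\<bar> * lp_norm p x"
    unfolding lp_norm_def eq suminf_mult[OF sm]
    using assms(1) suminf_nonneg[OF sm] by (simp add: powr_mult powr_powr)
qed

lemma absolutely_convex_lp_ball:
  assumes p: "1 \<le> p"
  shows "absolutely_convex {x \<in> lp_space p. lp_norm p x \<le> R}"
proof (unfold absolutely_convex_def, intro ballI allI impI)
  fix x y and a b :: real
  assume xy: "x \<in> {x \<in> lp_space p. lp_norm p x \<le> R}" "y \<in> {x \<in> lp_space p. lp_norm p x \<le> R}"
    and ab: "\<bar>a\<bar> + \<bar>b\<bar> \<le> 1"
  have in_lp: "a *\<^sub>R x \<in> lp_space p" "b *\<^sub>R y \<in> lp_space p" using xy p by (auto intro!: lp_scaleR)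
  have "lp_norm p (a *\<^sub>R x + b *\<^sub>R y) \<le> lp_norm p (a *\<^sub>R x) + lp_norm p (b *\<^sub>R y)"
    by (rule lp_norm_triangle[OF p in_lp])
  also have "\<dots> = \<bar>a\<bar> * lp_norm p x + \<bar>b\<bar> * lp_norm p y" using xy p by (simp add: lp_scaleR)
  also have "\<dots> \<le> \<bar>a\<bar> * R + \<bar>b\<bar> * R" using xy by (intro add_mono mult_left_mono) auto
  also have "\<dots> \<le> 1 * R" unfolding distrib_right[symmetric]
    using ab xy(1) lp_norm_nonneg[of p x] by (intro mult_right_mono) auto
  finally show "a *\<^sub>R x + b *\<^sub>R y \<in> {x \<in> lp_space p. lp_norm p x \<le> R}"
    using lp_space_add[OF p in_lp] by simp
qed

lemma sum_fun_apply: "(\<Sum>i\<in>I. F i) n = (\<Sum>i\<in>I. F i n)" for F :: "'i \<Rightarrow> 'b \<Rightarrow> 'c::comm_monoid_add"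
  by (induction I rule: infinite_finite_induct) auto

text \<open>
  A word at Hamming distance at most \<open>N div 2\<close> from \<open>f\<close> is determined by the set of positions where
  it differs from \<open>f\<close> and its letters there.
\<close>

lemma hamming_ball_card:
  assumes f: "f \<in> {..<N} \<rightarrow>\<^sub>E {..<q}" and q: "1 \<le> q"
  shows "card {g \<in> {..<N} \<rightarrow>\<^sub>E {..<q}. card {a\<in>{..<N}. f a \<noteq> g a} \<le> N div 2} \<le> 2 ^ N * q ^ (N div 2)"
proof -
  define \<D> where "\<D> = {D \<in> Pow {..<N}. card D \<le> N div 2}"
  define \<Phi> where "\<Phi> D h = (\<lambda>a. if a \<in> D then h a else f a)" for D and h :: "nat \<Rightarrow> nat"
  have fin: "finite \<D>" "card \<D> \<le> 2 ^ N"
    using card_mono[of "Pow {..<N}" \<D>] by (auto simp: \<D>_def card_Pow)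
  have "{g \<in> {..<N} \<rightarrow>\<^sub>E {..<q}. card {a\<in>{..<N}. f a \<noteq> g a} \<le> N div 2} \<subseteq> (\<Union>D\<in>\<D>. \<Phi> D ` (D \<rightarrow>\<^sub>E {..<q}))"
  proof
    fix g assume "g \<in> {g \<in> {..<N} \<rightarrow>\<^sub>E {..<q}. card {a\<in>{..<N}. f a \<noteq> g a} \<le> N div 2}"
    then have g: "g \<in> {..<N} \<rightarrow>\<^sub>E {..<q}" "card {a\<in>{..<N}. f a \<noteq> g a} \<le> N div 2" by auto
    define D where "D = {a\<in>{..<N}. f a \<noteq> g a}"
    have D: "D \<in> \<D>" using g(2) by (auto simp: D_def \<D>_def)
    have "g a = \<Phi> D (restrict g D) a" for a
    proof (cases "a < N")
      case False
      then have "g a = undefined" "f a = undefined" using g(1) f by (auto simp: PiE_iff extensional_def)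
      then show ?thesis using False by (simp add: \<Phi>_def D_def)
    qed (auto simp: \<Phi>_def D_def)
    then have "g = \<Phi> D (restrict g D)" by blast
    moreover have "restrict g D \<in> D \<rightarrow>\<^sub>E {..<q}" using g(1) by (auto simp: D_def)
    ultimately show "g \<in> (\<Union>D\<in>\<D>. \<Phi> D ` (D \<rightarrow>\<^sub>E {..<q}))" using D by blast
  qed
  then have "card {g \<in> {..<N} \<rightarrow>\<^sub>E {..<q}. card {a\<in>{..<N}. f a \<noteq> g a} \<le> N div 2}
      \<le> card (\<Union>D\<in>\<D>. \<Phi> D ` (D \<rightarrow>\<^sub>E {..<q}))"
    using fin by (intro card_mono) (auto simp: \<D>_def intro!: finite_PiE intro: finite_subset)
  also have "\<dots> \<le> (\<Sum>D\<in>\<D>. card (\<Phi> D ` (D \<rightarrow>\<^sub>E {..<q})))" by (rule card_UN_le[OF fin(1)])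
  also have "\<dots> \<le> (\<Sum>D\<in>\<D>. q ^ (N div 2))"
  proof (rule sum_mono)
    fix D assume D: "D \<in> \<D>"
    then have "finite D" by (auto simp: \<D>_def intro: finite_subset)
    then have "card (\<Phi> D ` (D \<rightarrow>\<^sub>E {..<q})) \<le> q ^ card D"
      using card_image_le[of "D \<rightarrow>\<^sub>E {..<q}" "\<Phi> D"] by (simp add: card_PiE finite_PiE)
    also have "\<dots> \<le> q ^ (N div 2)" using D q by (intro power_increasing) (auto simp: \<D>_def)
    finally show "card (\<Phi> D ` (D \<rightarrow>\<^sub>E {..<q})) \<le> q ^ (N div 2)" .
  qed
  also have "\<dots> \<le> 2 ^ N * q ^ (N div 2)" using fin by simp
  finally show ?thesis .
qed

text \<open>
  The word \<open>f\<close> of length \<open>N\<close> over \<open>q\<close> letters is encoded by its graph: block \<open>a\<close> of \<open>q\<close> coordinates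
  carries a single spike at the letter \<open>f a\<close>.
\<close>

definition code_vector :: "real \<Rightarrow> nat \<Rightarrow> nat \<Rightarrow> (nat \<Rightarrow> nat) \<Rightarrow> nat \<Rightarrow> real" where
  "code_vector c N q f = (\<Sum>a<N. (1 / real N) *\<^sub>R spike c (a * q + f a))"

lemma code_vector_apply:
  assumes "a < N" "i < q" "\<And>b. b < N \<Longrightarrow> f b < q"
  shows "code_vector c N q f (a * q + i) = (if f a = i then c / real N else 0)"
proof -
  have inj: "b * q + f b = a * q + i \<longleftrightarrow> b = a \<and> f a = i" if "b < N" for b
  proof
    assume eq: "b * q + f b = a * q + i"
    have "(b * q + f b) div q = b" "(a * q + i) div q = a" using assms that by auto
    then have "b = a" using eq by simp
    then show "b = a \<and> f a = i" using eq by simp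
  qed auto
  have "code_vector c N q f (a * q + i) = (\<Sum>b<N. if b = a then (if f a = i then c / real N else 0) else 0)"
    unfolding code_vector_def sum_fun_apply
  proof (rule sum.cong[OF refl])
    fix b assume "b \<in> {..<N}"
    then have "a * q + i = b * q + f b \<longleftrightarrow> b = a \<and> f a = i" using inj[of b] by auto
    then show "((1 / real N) *\<^sub>R spike c (b * q + f b)) (a * q + i) = (if b = a then if f a = i then c / real N else 0 else 0)"
      by (auto simp: scaleR_fun_def spike_def)
  qed
  then show ?thesis using assms(1) by simp
qed

text \<open>
  Every position where the words differ contributes at least one coordinate at which one of the
  vectors has the value \<open>c / N\<close> and the other vanishes.
\<close>

lemma code_vector_dist:
  assumes p: "1 \<le> p" and c: "0 \<le> c"
    and fg: "\<And>b. b < N \<Longrightarrow> f b < q" "\<And>b. b < N \<Longrightarrow> g b < q"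
    and lp: "code_vector c N q f - code_vector c N q g \<in> lp_space p"
  shows "(c / real N) * real (card {a\<in>{..<N}. f a \<noteq> g a}) powr (1/p) \<le> lp_dist p (code_vector c N q f) (code_vector c N q g)"
proof -
  define D where "D = {a\<in>{..<N}. f a \<noteq> g a}"
  define z where "z = code_vector c N q f - code_vector c N q g"
  have inj: "inj_on (\<lambda>a. a * q + f a) D"
  proof (rule inj_onI)
    fix a b assume ab: "a \<in> D" "b \<in> D" and eq: "a * q + f a = b * q + f b"
    have "f a < q" "f b < q" using fg ab by (auto simp: D_def)
    then have "a = (a * q + f a) div q" "(b * q + f b) div q = b" by auto
    then show "a = b" unfolding eq by (rule trans)
  qed
  have zD: "\<bar>z (a * q + f a)\<bar> = c / real N" if "a \<in> D" for a
    using that c code_vector_apply[of a N "f a" q f c] code_vector_apply[of a N "f a" q g c] fg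
    by (auto simp: z_def D_def)
  have "real (card D) * (c / real N) powr p = (\<Sum>a\<in>D. \<bar>z (a * q + f a)\<bar> powr p)"
    using zD by simp
  also have "\<dots> = (\<Sum>n\<in>(\<lambda>a. a * q + f a) ` D. \<bar>z n\<bar> powr p)"
    by (subst sum.reindex[OF inj]) simp
  also have "\<dots> \<le> (\<Sum>n. \<bar>z n\<bar> powr p)"
    using lp by (intro sum_le_suminf) (auto simp: z_def lp_space_def D_def)
  finally have "(real (card D) * (c / real N) powr p) powr (1/p) \<le> lp_norm p z"
    unfolding lp_norm_def using p by (intro powr_mono2) auto
  then show ?thesis
    using p c by (simp add: powr_mult powr_powr lp_dist_def z_def D_def mult.commute)
qed

text \<open>
  Two code vectors in a ball of radius \<open>\<epsilon>\<close> are at distance at most \<open>2 \<epsilon>\<close>. If this is below the claimed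
  bound, their words differ in fewer than \<open>N / 2\<close> positions, so a ball contains at most
  \<open>2 ^ N q ^ (N / 2)\<close> of the \<open>q ^ N\<close> vectors. For \<open>q = 4 ^ (b + 1)\<close> and \<open>n \<le> b N\<close> a cover
  needs more than \<open>2 ^ (n - 1)\<close> balls.
\<close>

lemma code_vectors_cover_radius:
  assumes p: "1 \<le> p" and c: "0 < c" and N: "1 \<le> N" and b: "n \<le> b * N"
    and F: "finite F" "card F \<le> 2 ^ (n - 1)" "F \<subseteq> lp_space p" and n: "1 \<le> n" 
    and S: "S \<subseteq> lp_space p" "S \<subseteq> (\<Union>y\<in>F. Metric_space.mcball (lp_space p) (lp_dist p) y \<epsilon>)"
    and code: "\<And>f. f \<in> {..<N} \<rightarrow>\<^sub>E {..<2 ^ (2 * b + 2)} \<Longrightarrow> code_vector c N (2 ^ (2 * b + 2)) f \<in> S"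
  shows "(c / real N) * (real N / 2) powr (1/p) \<le> 2 * \<epsilon>"
proof (rule ccontr)
  interpret Metric_space "lp_space p" "lp_dist p" by (rule Metric_space_lp[OF p])
  assume "\<not> ?thesis"
  then have small: "2 * \<epsilon> < (c / real N) * (real N / 2) powr (1/p)" by simp
  define q :: nat where "q = 2 ^ (2 * b + 2)"
  have q: "1 \<le> q" by (simp add: q_def)
  define P where "P = {..<N} \<rightarrow>\<^sub>E {..<q}"
  define x where "x = code_vector c N q"
  have xS: "x f \<in> S" if "f \<in> P" for f using code that by (simp add: x_def P_def q_def)
  have P: "finite P" "card P = q ^ N" by (auto simp: P_def finite_PiE card_PiE)
  define B where "B y = {f \<in> P. x f \<in> mcball y \<epsilon>}" for y
  have "P \<subseteq> (\<Union>y\<in>F. B y)" using xS S(2) by (fastforce simp: B_def)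
  moreover have "finite (\<Union>y\<in>F. B y)" using F P by (auto simp: B_def)
  ultimately have "q ^ N \<le> card (\<Union>y\<in>F. B y)" using P card_mono by metis
  also have "\<dots> \<le> (\<Sum>y\<in>F. card (B y))" by (rule card_UN_le[OF F(1)])
  also have "\<dots> \<le> (\<Sum>y\<in>F. 2 ^ N * q ^ (N div 2))"
  proof (rule sum_mono)
    fix y assume "y \<in> F"
    show "card (B y) \<le> 2 ^ N * q ^ (N div 2)"
    proof (cases "B y = {}")
      case False
      then obtain f where f: "f \<in> P" "x f \<in> mcball y \<epsilon>" by (auto simp: B_def)
      have "B y \<subseteq> {g \<in> P. card {a\<in>{..<N}. f a \<noteq> g a} \<le> N div 2}"
      proof
        fix g assume "g \<in> B y"
        then have g: "g \<in> P" "x g \<in> mcball y \<epsilon>" by (auto simp: B_def)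
        define H where "H = card {a\<in>{..<N}. f a \<noteq> g a}"
        have xfg: "x f \<in> lp_space p" "x g \<in> lp_space p" "y \<in> lp_space p" using f g by (auto simp: mcball_def)
        have "- x g \<in> lp_space p" using xfg(2) by (simp add: lp_space_def)
        then have "x f - x g \<in> lp_space p" using lp_space_add[OF p xfg(1), of "- x g"] by simp
        then have "(c / real N) * real H powr (1/p) \<le> lp_dist p (x f) (x g)"
          unfolding H_def x_def using f g c by (intro code_vector_dist[OF p]) (auto simp: P_def)
        also have "\<dots> \<le> lp_dist p (x f) y + lp_dist p y (x g)" using xfg by (intro triangle) auto
        also have "\<dots> \<le> 2 * \<epsilon>" using f g commute[of "x f" y] by (auto simp: mcball_def)
        finally have "(c / real N) * real H powr (1/p) < (c / real N) * (real N / 2) powr (1/p)" using small by simp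
        then have "real H powr (1/p) < (real N / 2) powr (1/p)" 
          using c N mult_less_cancel_left_pos[of "c / real N"] by simp
        moreover have "(real N / 2) powr (1/p) \<le> real H powr (1/p)" if "real N / 2 \<le> real H"
          using p that by (intro powr_mono2) auto
        ultimately have "real H < real N / 2" by linarith
        then have "H \<le> N div 2" by linarith
        then show "g \<in> {g \<in> P. card {a\<in>{..<N}. f a \<noteq> g a} \<le> N div 2}" using g by (simp add: H_def)
      qed
      then have "card (B y) \<le> card {g \<in> P. card {a\<in>{..<N}. f a \<noteq> g a} \<le> N div 2}"
        using P by (intro card_mono) auto
      also have "\<dots> \<le> 2 ^ N * q ^ (N div 2)"
        using hamming_ball_card[OF _ q] f unfolding P_def by auto
      finally show ?thesis .
    qed simp
  qed
  also have "\<dots> = card F * (2 ^ N * q ^ (N div 2))" by simp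
  also have "\<dots> \<le> 2 ^ (n - 1) * (2 ^ N * 2 ^ ((b + 1) * N))"
  proof (intro mult_mono F(2) order_refl)
    have "(2 * b + 2) * (N div 2) = (b + 1) * (2 * (N div 2))" by simp
    then have "q ^ (N div 2) = 2 ^ ((b + 1) * (2 * (N div 2)))" by (simp only: q_def power_mult[symmetric])
    also have "\<dots> \<le> 2 ^ ((b + 1) * N)" by (intro power_increasing mult_left_mono) auto
    finally show "q ^ (N div 2) \<le> 2 ^ ((b + 1) * N)" .
  qed auto
  also have "\<dots> = 2 ^ (n - 1 + N + (b + 1) * N)" by (simp add: power_add)
  finally have "(2::nat) ^ ((2 * b + 2) * N) \<le> 2 ^ (n - 1 + N + (b + 1) * N)"
    by (simp only: q_def power_mult)
  then have "(2 * b + 2) * N \<le> n - 1 + N + (b + 1) * N" by (subst (asm) power_increasing_iff) auto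
  then have "b * N \<le> n - 1" by (simp add: algebra_simps)
  then show False using b n by linarith
qed

definition log_decay :: "real \<Rightarrow> nat \<Rightarrow> real" where
  "log_decay a i = (1 + log 2 (real i + 1)) powr - a"

lemma one_plus_log_pos: "0 < 1 + log 2 (real i + 1)"
proof -
  have "0 \<le> log 2 (real i + 1)" by simp
  then show ?thesis by linarith
qed

lemma log_decay_pos: "0 < log_decay a i"
  unfolding log_decay_def powr_gt_zero using one_plus_log_pos[of i] by linarith

lemma log_decay_le:
  assumes "0 \<le> a" "2 ^ k \<le> i + 1"
  shows "log_decay a i \<le> real (k + 1) powr - a"
proof -
  have "real (2 ^ k) \<le> real (i + 1)" using assms(2) by (simp only: of_nat_le_iff)
  then have "2 ^ k \<le> real i + 1" by simp
  then have "log 2 (2 ^ k) \<le> log 2 (real i + 1)" by (subst log_le_cancel_iff) auto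
  then have "real k \<le> log 2 (real i + 1)" by (simp only: log_pow_cancel)
  then show ?thesis unfolding log_decay_def using assms(1) by (intro powr_mono2') auto
qed

lemma log_decay_ge:
  assumes "0 \<le> a" "i + 1 \<le> 2 ^ k"
  shows "real (k + 1) powr - a \<le> log_decay a i"
proof -
  have "real (i + 1) \<le> real (2 ^ k)" using assms(2) by (simp only: of_nat_le_iff)
  then have "real i + 1 \<le> 2 ^ k" by simp
  then have "log 2 (real i + 1) \<le> log 2 (2 ^ k)" by (subst log_le_cancel_iff) auto
  then have "log 2 (real i + 1) \<le> real k" by (simp only: log_pow_cancel)
  then show ?thesis unfolding log_decay_def using assms(1) one_plus_log_pos[of i] by (intro powr_mono2') auto
qed

lemma lp_dist_zero: "lp_dist p x 0 = lp_norm p x" "lp_dist p 0 x = lp_norm p x"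
  by (simp_all add: lp_dist_def lp_norm_def fun_diff_def)

context
  fixes p a :: real
  assumes p: "1 \<le> p" and a: "0 < a"
begin

interpretation lp: Metric_space "lp_space p" "lp_dist p" by (rule Metric_space_lp[OF p])

definition spikes :: "(nat \<Rightarrow> real) set" where
  "spikes = (\<lambda>i. spike (log_decay a i) i) ` UNIV"

lemma lp_dist_spikes: "lp_dist p (spike c i) (spike d j) \<le> \<bar>c\<bar> + \<bar>d\<bar>"
proof -
  have z: "spike 0 0 = 0" by (auto simp: spike_def)
  have "lp_dist p (spike c i) (spike d j) \<le> lp_dist p (spike c i) 0 + lp_dist p 0 (spike d j)"
    using p spike_lp[of p 0 0] by (intro lp.triangle) (auto simp: spike_lp z)
  also have "lp_dist p 0 (spike d j) = lp_dist p (spike d j) 0" by (rule lp.commute)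
  finally show ?thesis using p by (simp only: lp_dist_zero) (simp add: spike_lp)
qed

lemma spikes_subset_lp: "spikes \<subseteq> lp_space p"
  using p by (auto simp: spikes_def spike_lp)

lemma aco_spikes_bounded:
  shows zero_lp: "0 \<in> lp_space p" and "aco spikes \<subseteq> lp.mcball 0 1" "spikes \<subseteq> lp.mcball 0 1"
proof -
  show z: "0 \<in> lp_space p" by (simp add: lp_space_def)
  have le1: "log_decay a i \<le> 1" for i using log_decay_le[of a 0 i] a by simp
  have "spikes \<subseteq> {x \<in> lp_space p. lp_norm p x \<le> 1}"
    using p le1 less_imp_le[OF log_decay_pos] by (auto simp: spikes_def spike_lp)
  then have "aco spikes \<subseteq> {x \<in> lp_space p. lp_norm p x \<le> 1}"
    by (rule aco_minimal) (rule absolutely_convex_lp_ball[OF p])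
  then show *: "aco spikes \<subseteq> lp.mcball 0 1"
    using z by (auto simp: lp.mcball_def lp_dist_zero)
  then show "spikes \<subseteq> lp.mcball 0 1" using subset_aco by blast
qed

lemma spikes_totally_bounded: "lp.mtotally_bounded spikes"
  unfolding lp.mtotally_bounded_def
proof (intro allI impI)
  fix \<epsilon> :: real assume \<epsilon>: "0 < \<epsilon>"
  have "((\<lambda>k. real (k + 1) powr - a) \<longlongrightarrow> 0) sequentially"
    using a filterlim_compose[OF filterlim_real_sequentially filterlim_Suc] by (intro tendsto_neg_powr) auto
  then have "\<forall>\<^sub>F k in sequentially. real (k + 1) powr - a < \<epsilon> / 2"
    using \<epsilon> by (intro order_tendstoD) auto
  then obtain k where k: "real (k + 1) powr - a < \<epsilon> / 2" by (auto simp: eventually_sequentially)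
  define K where "K = (\<lambda>i. spike (log_decay a i) i) ` {..2 ^ k}"
  have "spikes \<subseteq> (\<Union>x\<in>K. lp.mball x \<epsilon>)"
  proof
    fix x assume "x \<in> spikes"
    then obtain i where x: "x = spike (log_decay a i) i" by (auto simp: spikes_def)
    have xlp: "x \<in> lp_space p" using p by (simp add: x spike_lp)
    show "x \<in> (\<Union>x\<in>K. lp.mball x \<epsilon>)"
    proof (cases "i \<le> 2 ^ k")
      case True
      then have "x \<in> K" by (auto simp: x K_def)
      then show ?thesis using xlp \<epsilon> by auto
    next
      case False
      define y where "y = spike (log_decay a (2 ^ k)) (2 ^ k)"
      have yK: "y \<in> K" "y \<in> lp_space p" using p by (auto simp: y_def K_def spike_lp)
      have "lp_dist p y x \<le> log_decay a (2 ^ k) + log_decay a i"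
        unfolding x y_def using lp_dist_spikes[of "log_decay a (2 ^ k)" "2 ^ k" "log_decay a i" i]
          log_decay_pos[of a i] log_decay_pos[of a "2 ^ k"] by simp
      also have "\<dots> < \<epsilon>" using log_decay_le[of a k i] log_decay_le[of a k "2 ^ k"] k a False by simp
      finally have "x \<in> lp.mball y \<epsilon>" using xlp yK by simp
      then show ?thesis using yK by blast
    qed
  qed
  then show "\<exists>K. finite K \<and> K \<subseteq> spikes \<and> spikes \<subseteq> (\<Union>x\<in>K. lp.mball x \<epsilon>)"
    by (intro exI[of _ K]) (auto simp: K_def spikes_def)
qed

text \<open>
  The centres are the first \<open>2 ^ (n - 1) - 1\<close> points of the set and the origin, which takes care of the
  remaining, shorter spikes.
\<close>

lemma spikes_entropy_le:
  assumes "1 \<le> n"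
  shows "dyadic_entropy_number (lp_space p) (lp_dist p) spikes n \<le> real n powr - a"
  unfolding dyadic_entropy_number_def
proof (rule lp.entropy_number_le)
  define F where "F = insert 0 ((\<lambda>i. spike (log_decay a i) i) ` {..<2 ^ (n - 1) - 1})"
  show "finite F" "F \<noteq> {}" by (auto simp: F_def)
  show "F \<subseteq> lp_space p" using p zero_lp by (auto simp: F_def spike_lp)
  have "card F \<le> Suc (card ((\<lambda>i. spike (log_decay a i) i) ` {..<2 ^ (n - 1) - 1 :: nat}))"
    unfolding F_def by (rule card_insert_le_m1) auto
  also have "\<dots> \<le> Suc (2 ^ (n - 1) - 1)" using card_image_le[of "{..<2 ^ (n - 1) - 1 :: nat}"] by fastforce
  finally show "card F \<le> 2 ^ (n - 1)" by simp
  show "spikes \<subseteq> (\<Union>x\<in>F. lp.mcball x (real n powr - a))"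
  proof
    fix x assume "x \<in> spikes"
    then obtain i where x: "x = spike (log_decay a i) i" by (auto simp: spikes_def)
    have xlp: "x \<in> lp_space p" using p by (simp add: x spike_lp)
    show "x \<in> (\<Union>x\<in>F. lp.mcball x (real n powr - a))"
    proof (cases "i < 2 ^ (n - 1) - 1")
      case True
      then have "x \<in> F" by (auto simp: x F_def)
      then show ?thesis using xlp by auto
    next
      case False
      have "log_decay a i \<le> real n powr - a" using log_decay_le[of a "n - 1" i] a False assms by simp
      moreover have "lp_dist p 0 x = log_decay a i"
        using p log_decay_pos[of a i] unfolding lp_dist_zero by (simp add: x spike_lp)
      ultimately have "x \<in> lp.mcball 0 (real n powr - a)" using xlp zero_lp by simp
      then show ?thesis by (auto simp: F_def)
    qed
  qed
qed simp

lemma code_vector_in_aco_spikes: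
  assumes f: "\<And>b. b < N \<Longrightarrow> f b < q" and N: "1 \<le> N" and m: "N * q \<le> 2 ^ k"
  shows "code_vector (real (k + 1) powr - a) N q f \<in> aco spikes"
proof -
  define c where "c = real (k + 1) powr - a"
  have spike_c: "spike c i \<in> aco spikes" if i: "i < N * q" for i
  proof -
    have "c \<le> log_decay a i" unfolding c_def using i m a by (intro log_decay_ge) auto
    then have "\<bar>c / log_decay a i\<bar> + \<bar>0\<bar> \<le> 1" using log_decay_pos[of a i] by (simp add: c_def)
    moreover have "spike (log_decay a i) i \<in> aco spikes"
      by (rule subsetD[OF subset_aco]) (simp add: spikes_def)
    ultimately have "(c / log_decay a i) *\<^sub>R spike (log_decay a i) i + 0 *\<^sub>R spike (log_decay a i) i \<in> aco spikes"
      using absolutely_convex_aco[of spikes] unfolding absolutely_convex_def by blast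
    also have "(c / log_decay a i) *\<^sub>R spike (log_decay a i) i + 0 *\<^sub>R spike (log_decay a i) i = spike c i"
      using log_decay_pos[of a i] by (auto simp: spike_def scaleR_fun_def fun_eq_iff)
    finally show ?thesis .
  qed
  have conv: "convex (aco spikes)"
    unfolding convex_def
  proof (intro ballI allI impI)
    fix x y and u v :: real assume "x \<in> aco spikes" "y \<in> aco spikes" "0 \<le> u" "0 \<le> v" "u + v = 1"
    then show "u *\<^sub>R x + v *\<^sub>R y \<in> aco spikes"
      using absolutely_convex_aco[of spikes] unfolding absolutely_convex_def by simp
  qed
  have "(\<Sum>b<N. (1 / real N) *\<^sub>R spike c (b * q + f b)) \<in> aco spikes"
  proof (rule convex_sum[OF _ conv])
    fix b assume b: "b \<in> {..<N}"
    have "b * q + f b < Suc b * q" using f b by simp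
    also have "\<dots> \<le> N * q" using b by (intro mult_right_mono) auto
    finally show "spike c (b * q + f b) \<in> aco spikes" by (rule spike_c)
  qed (use N in auto)
  then show ?thesis by (simp add: code_vector_def c_def)
qed

text \<open>
  The alphabet size \<open>2 ^ (2 j + 2)\<close> yields about \<open>j\<close> bits per position, so \<open>N\<close> must be about \<open>2 ^ j / j\<close>.
  Then all coordinates involved have index below \<open>2 ^ (3 j + 3)\<close>, where the spikes still have height at
  least \<open>(3 j + 4) powr - a\<close>.
\<close>

lemma aco_spikes_entropy_ge:
  assumes j: "1 \<le> j"
  defines "N \<equiv> 2 ^ j div j + 1"
  shows "(real (3 * j + 4) powr - a / real N) * (real N / 2) powr (1/p) / 2
    \<le> dyadic_entropy_number (lp_space p) (lp_dist p) (aco spikes) (2 ^ j)"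
  unfolding dyadic_entropy_number_def
proof (rule lp.entropy_number_ge[OF zero_lp aco_spikes_bounded(2)])
  fix \<epsilon> F assume F: "finite F" "card F \<le> 2 ^ (2 ^ j - 1)" "F \<subseteq> lp_space p" "aco spikes \<subseteq> (\<Union>x\<in>F. lp.mcball x \<epsilon>)"
  have "2 ^ j mod j < j" using j by simp
  moreover have "2 ^ j div j * j + 2 ^ j mod j = 2 ^ j" by (rule div_mult_mod_eq)
  ultimately have "2 ^ j \<le> 2 ^ j div j * j + j" by linarith
  then have Nj: "2 ^ j \<le> j * N" by (simp add: N_def algebra_simps)
  have "2 ^ j div j \<le> (2::nat) ^ j" by (rule div_le_dividend)
  then have "N \<le> 2 ^ j + 2 ^ j" unfolding N_def by (intro add_mono) auto
  then have N2: "N \<le> 2 ^ (j + 1)" by simp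
  have "N * 2 ^ (2 * j + 2) \<le> 2 ^ (j + 1) * 2 ^ (2 * j + 2)" using N2 by (rule mult_right_mono) simp
  also have "\<dots> = 2 ^ (j + 1 + (2 * j + 2))" by (simp only: power_add)
  also have "j + 1 + (2 * j + 2) = 3 * j + 3" by simp
  finally have m: "N * 2 ^ (2 * j + 2) \<le> 2 ^ (3 * j + 3)" .
  have "(real (3 * j + 4) powr - a / real N) * (real N / 2) powr (1/p) \<le> 2 * \<epsilon>"
  proof (rule code_vectors_cover_radius[OF p _ _ Nj F(1-3) _ _ F(4)])
    show "aco spikes \<subseteq> lp_space p" using aco_spikes_bounded(2) by (auto simp: lp.mcball_def)
    fix f :: "nat \<Rightarrow> nat" assume f: "f \<in> {..<N} \<rightarrow>\<^sub>E {..<2 ^ (2 * j + 2)}"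
    have "f b < 2 ^ (2 * j + 2)" if "b < N" for b
      using PiE_mem[OF f, of b] that by (simp only: lessThan_iff)
    moreover have "1 \<le> N" by (simp add: N_def)
    ultimately have "code_vector (real (3 * j + 3 + 1) powr - a) N (2 ^ (2 * j + 2)) f \<in> aco spikes"
      by (rule code_vector_in_aco_spikes[OF _ _ m])
    moreover have "3 * j + 3 + 1 = 3 * j + 4" by simp
    ultimately show "code_vector (real (3 * j + 4) powr - a) N (2 ^ (2 * j + 2)) f \<in> aco spikes" by (simp only:)
  qed (auto simp: N_def)
  then show "(real (3 * j + 4) powr - a / real N) * (real N / 2) powr (1/p) / 2 \<le> \<epsilon>" by simp
qed simp

end

text \<open>
  With \<open>a = 1 / r + (\<alpha> - \<beta>)\<close> the condensed sum of \<open>A\<close> is geometric with ratio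
  \<open>2 powr (- (\<alpha> - \<beta>) s)\<close>, while the exponents in the condensed sum of \<open>aco A\<close> for \<open>\<beta>\<close> add up to
  exactly \<open>-1\<close>, so that it dominates the harmonic series.
\<close>

theorem aco_dyadic_entropy_lorentz_optimal:
  fixes p p' r s \<alpha> \<beta> :: real
  assumes p: "1 < p" and pp: "1 / p + 1 / p' = 1" and r: "0 < r" and s: "0 < s"
    and \<alpha>: "\<alpha> = 1 / s + 1 / p' - 1 / r" and \<beta>: "\<beta> < \<alpha>"
  shows "\<exists>A \<subseteq> lp_space p.
          Metric_space.mtotally_bounded (lp_space p) (lp_dist p) A \<and>
          dyadic_entropy_number (lp_space p) (lp_dist p) A \<in> lorentz r s 0 \<and>
          dyadic_entropy_number (lp_space p) (lp_dist p) (aco A) \<notin> lorentz p' s \<beta>"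
proof -
  have p1: "1 \<le> p" using p by simp
  interpret lp: Metric_space "lp_space p" "lp_dist p" by (rule Metric_space_lp[OF p1])
  have ip: "1 / p' = 1 - 1 / p" using pp by simp
  have "0 < 1 / p'" using p unfolding ip by (auto simp: field_simps)
  then have p': "0 < p'" by simp
  define \<theta> where "\<theta> = \<alpha> - \<beta>"
  have \<theta>: "0 < \<theta>" using \<beta> by (simp add: \<theta>_def)
  define a where "a = 1 / r + \<theta>"
  have a: "0 < a" using r \<theta> by (simp add: a_def add_pos_pos)
  define A where "A = spikes a"
  define \<xi> where "\<xi> = dyadic_entropy_number (lp_space p) (lp_dist p) A"
  define \<zeta> where "\<zeta> = dyadic_entropy_number (lp_space p) (lp_dist p) (aco A)"
  note bnd = aco_spikes_bounded[OF p1 a, folded A_def]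
  have \<xi>: "0 \<le> \<xi> n" "antimono_on {1..} \<xi>" for n
    unfolding \<xi>_def by (rule lp.dyadic_entropy_nonneg[OF bnd(1,3)] lp.dyadic_entropy_antimono[OF bnd(1,3)])+
  have \<zeta>: "0 \<le> \<zeta> n" "antimono_on {1..} \<zeta>" for n
    unfolding \<zeta>_def by (rule lp.dyadic_entropy_nonneg[OF bnd(1,2)] lp.dyadic_entropy_antimono[OF bnd(1,2)])+
  have "summable (lorentz_term r s 0 \<xi>)"
  proof (rule summable_comparison_test'[where N = 0])
    show "summable (\<lambda>j. (2 powr (- \<theta> * s)) ^ j)"
      using \<theta> s by (intro summable_geometric) (simp add: powr_less_one)
    fix j
    have "\<xi> (2 ^ j) \<le> real (2 ^ j) powr - a"
      unfolding \<xi>_def A_def by (rule spikes_entropy_le[OF p1 a]) simp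
    also have "\<dots> = 2 powr (- a * real j)" by (simp add: powr_realpow[symmetric] powr_powr mult.commute)
    finally have "\<xi> (2 ^ j) powr s \<le> (2 powr (- a * real j)) powr s" using \<xi> s by (intro powr_mono2) auto
    then have "2 powr (real j * s / r) * \<xi> (2 ^ j) powr s \<le> 2 powr (real j * s / r) * 2 powr (- a * real j * s)"
      by (simp add: powr_powr)
    also have "\<dots> = (2 powr (- \<theta> * s)) ^ j"
      by (simp add: powr_add[symmetric] powr_realpow[symmetric] powr_powr a_def algebra_simps)
    finally show "norm (lorentz_term r s 0 \<xi> j) \<le> (2 powr (- \<theta> * s)) ^ j" by (simp add: lorentz_term_def)
  qed
  then have in_r: "\<xi> \<in> lorentz r s 0" using lorentz_iff_dyadic[OF r s, of \<xi> 0] \<xi> by simp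
  define h :: real where "h = (1/2) powr (1/p) / 2"
  \<comment> \<open>The powers of \<open>4\<close> come from \<open>3 j + 4 \<le> 4 (j + 1)\<close> and \<open>N (j + 1) \<le> 4 * 2 ^ j\<close>.\<close>
  define K where "K = h powr s * 4 powr (- a * s) * 4 powr (- s / p')"
  have h: "0 < h" by (simp add: h_def)
  then have K: "0 < K" by (simp add: K_def)
  have lower: "K * (1 / real (j + 1)) \<le> lorentz_term p' s \<beta> \<zeta> j" if j: "1 \<le> j" for j
  proof -
    define N :: nat where "N = 2 ^ j div j + 1"
    define x where "x = real (j + 1)"
    have x: "1 \<le> x" by (simp add: x_def)
    have N1: "1 \<le> N" by (simp add: N_def)
    have "N * x \<le> 4 * 2 ^ j"
    proof -
      have "j \<le> 2 ^ j" using less_exp[of j] by simp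
      moreover have "N * j = 2 ^ j div j * j + j" by (simp add: N_def algebra_simps)
      ultimately have "N * j \<le> 2 * 2 ^ j" using div_times_less_eq_dividend[of "2 ^ j" j] by linarith
      moreover have "N * (j + 1) \<le> N * (2 * j)" using j by (intro mult_le_mono2) simp
      moreover have "N * (2 * j) = 2 * (N * j)" by simp
      ultimately have "N * (j + 1) \<le> 4 * 2 ^ j" by linarith
      then have "real (N * (j + 1)) \<le> real (4 * 2 ^ j)" by (simp only: of_nat_le_iff)
      then show ?thesis unfolding x_def by (simp only: of_nat_mult of_nat_numeral of_nat_power)
    qed
    then have Nx: "real N \<le> 4 * 2 ^ j / x" using x by (simp add: pos_le_divide_eq)
    have "h * (4 * x) powr - a * (4 * 2 ^ j / x) powr (- 1 / p')
        \<le> h * real (3 * j + 4) powr - a * real N powr (- 1 / p')"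
    proof (intro mult_mono order_refl)
      show "(4 * x) powr - a \<le> real (3 * j + 4) powr - a" using a by (intro powr_mono2') (auto simp: x_def)
      show "(4 * 2 ^ j / x) powr (- 1 / p') \<le> real N powr (- 1 / p')"
        using Nx N1 p' by (intro powr_mono2') auto
    qed (use h in auto)
    also have "\<dots> = (real (3 * j + 4) powr - a / real N) * (real N / 2) powr (1/p) / 2"
    proof -
      have e: "- 1 / p' = 1 / p - 1" using ip by simp
      have "real N powr (- 1 / p') = real N powr (1/p) / real N" unfolding e using N1 by (simp add: powr_diff)
      then show ?thesis by (simp add: powr_divide h_def)
    qed
    also have "\<dots> \<le> \<zeta> (2 ^ j)" unfolding \<zeta>_def A_def N_def by (rule aco_spikes_entropy_ge[OF p1 a j])
    finally have le: "h * (4 * x) powr - a * (4 * 2 ^ j / x) powr (- 1 / p') \<le> \<zeta> (2 ^ j)" .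
    have "K * x powr (- a * s + s / p') * 2 powr (- real j * s / p') =
       (h * (4 * x) powr - a * (4 * 2 ^ j / x) powr (- 1 / p')) powr s"
    proof -
      have "(4 * 2 ^ j / x) powr (- 1 / p') = 4 powr (- 1 / p') * 2 powr (- real j / p') * x powr (1 / p')"
        using x by (simp add: powr_divide powr_mult powr_realpow[symmetric] powr_powr powr_minus field_simps)
      moreover have "x powr (- a * s + s / p') = x powr (- a * s) * x powr (s / p')" by (rule powr_add)
      ultimately show ?thesis using x h by (simp add: K_def powr_mult powr_powr mult_ac)
    qed
    also have "\<dots> \<le> \<zeta> (2 ^ j) powr s" using le s h by (intro powr_mono2) auto
    finally have z: "K * x powr (- a * s + s / p') * 2 powr (- real j * s / p') \<le> \<zeta> (2 ^ j) powr s" .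
    have "- \<beta> * s + (- a * s + s / p') = - 1"
    proof -
      have "- \<beta> + - a + 1 / p' = - 1 / s" by (simp add: a_def \<theta>_def \<alpha>)
      then have "(- \<beta> + - a + 1 / p') * s = - 1" using s by simp
      then show ?thesis by (simp add: algebra_simps)
    qed
    then have "x powr (- \<beta> * s) * x powr (- a * s + s / p') = 1 / x"
      using x by (simp only: powr_add[symmetric]) (simp add: powr_minus divide_inverse)
    then have "K * (1 / x) = (x powr (- \<beta> * s) * 2 powr (real j * s / p')) * (K * x powr (- a * s + s / p') * 2 powr (- real j * s / p'))"
      by (simp add: powr_minus mult_ac)
    also have "\<dots> \<le> (x powr (- \<beta> * s) * 2 powr (real j * s / p')) * \<zeta> (2 ^ j) powr s"
      by (intro mult_left_mono z) auto
    finally show ?thesis by (simp add: lorentz_term_def x_def)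
  qed
  have "\<not> summable (lorentz_term p' s \<beta> \<zeta>)"
  proof
    assume "summable (lorentz_term p' s \<beta> \<zeta>)"
    then have "summable (\<lambda>j. K * (1 / real (j + 1)))"
      by (rule summable_comparison_test'[where N = 1]) (use lower K in auto)
    then have "summable (\<lambda>j. 1 / real (j + 1))" using K by (simp only: summable_cmult_iff) simp
    then have "summable (\<lambda>j. 1 / real (Suc j))" by simp
    then have "summable (\<lambda>j. inverse (real j))" unfolding divide_inverse mult_1
      by (subst (asm) summable_Suc_iff)
    then show False using not_summable_harmonic by blast
  qed
  then have "\<zeta> \<notin> lorentz p' s \<beta>" using lorentz_iff_dyadic[OF p' s, of \<zeta> \<beta>] \<zeta> by simp
  then show ?thesis
    using in_r spikes_subset_lp[OF p1 a] spikes_totally_bounded[OF p1 a]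
    unfolding \<xi>_def \<zeta>_def A_def by blast
qed

section \<open>Entropy of absolutely convex hulls in spaces of type \<open>p\<close>\<close>

theorem theorem2p1:
  fixes p p' r s \<alpha> :: real
  assumes "1 < p" and "p \<le> 2" and "1 / p + 1 / p' = 1"
    and "0 < r" and "r < p'" and "0 < s"
    and "\<alpha> = 1 / s + 1 / p' - 1 / r"
  shows
    "(of_type TYPE('a::banach) p \<longrightarrow>
       (\<forall>A :: 'a set. Metric_space.mtotally_bounded UNIV dist A \<longrightarrow>
          dyadic_entropy_number UNIV dist A \<in> lorentz r s 0 \<longrightarrow>
          dyadic_entropy_number UNIV dist (aco A) \<in> lorentz p' s \<alpha>)) \<and>
     (\<forall>\<beta><\<alpha>. \<exists>A \<subseteq> lp_space p.
          Metric_space.mtotally_bounded (lp_space p) (lp_dist p) A \<and>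
          dyadic_entropy_number (lp_space p) (lp_dist p) A \<in> lorentz r s 0 \<and>
          dyadic_entropy_number (lp_space p) (lp_dist p) (aco A) \<notin> lorentz p' s \<beta>)"
proof (intro conjI impI allI)
  fix A :: "'a set"
  assume type: "of_type TYPE('a) p" and A: "Metric_space.mtotally_bounded UNIV dist A"
    and eA: "dyadic_entropy_number UNIV dist A \<in> lorentz r s 0"
  have "bounded A" using Met_TC.mtotally_bounded_imp_mbounded[OF A] by simp
  then show "dyadic_entropy_number UNIV dist (aco A) \<in> lorentz p' s \<alpha>"
    using aco_dyadic_entropy_lorentz[OF type assms(1,3,4,5,6,7) _ eA] by blast
next
  fix \<beta> assume "\<beta> < \<alpha>"
  then show "\<exists>A \<subseteq> lp_space p.
          Metric_space.mtotally_bounded (lp_space p) (lp_dist p) A \<and>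
          dyadic_entropy_number (lp_space p) (lp_dist p) A \<in> lorentz r s 0 \<and>
          dyadic_entropy_number (lp_space p) (lp_dist p) (aco A) \<notin> lorentz p' s \<beta>"
    using aco_dyadic_entropy_lorentz_optimal[OF assms(1,3,4,6,7)] by blast
qed

end
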